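(* Let $\Phi$ be the root system of type $G_2$ with simple roots $a$ (short) and $b$ (long), and fix a Chevalley basis of the complex simple Lie algebra of type $G_2$ whose structure constants $N_{a,b}$, $N_{a,a+b}$, $N_{a,2a+b}$, $N_{b,3a+b}$ (those corresponding to the extraspecial pairs) are all positive. Let $K$ be a field (or an associative commutative ring with identity), and let $x_r(t)$ ($r\in\Phi$, $t\in K$) be the root elements of the Chevalley group of type $G_2$ over $K$ attached to this Chevalley basis. With $[x,y]=x^{-1}y^{-1}xy$, the following identities hold for all $t,u\in K$. Positive roots: 1. $[x_b(u),x_a(t)]=x_{a+b}(-tu)\,x_{2a+b}(t^2u)\,x_{3a+b}(-t^3u)\,x_{3a+2b}(-t^3u^2)$ 2. $[x_a(u),x_b(t)]=x_{a+b}(tu)\,x_{2a+b}(-tu^2)\,x_{3a+b}(tu^3)\,x_{3a+2b}(-2t^2u^3)$ 3. $[x_{a+b}(u),x_a(t)]=x_{2a+b}(-2tu)\,x_{3a+b}(3t^2u)\,x_{3a+2b}(-3tu^2)$ 4. $[x_{2a+b}(u),x_a(t)]=x_{3a+b}(-3tu)$ 5. $[x_{3a+b}(u),x_b(t)]=x_{3a+2b}(-tu)$ 6. $[x_{2a+b}(u),x_{a+b}(t)]=x_{3a+2b}(3tu)$ Negative roots: 7. $[x_{-b}(u),x_{-a}(t)]=x_{-a-b}(tu)\,x_{-2a-b}(t^2u)\,x_{-3a-b}(t^3u)\,x_{-3a-2b}(-t^3u^2)$ 8. $[x_{-a}(u),x_{-b}(t)]=x_{-a-b}(-tu)\,x_{-2a-b}(-tu^2)\,x_{-3a-b}(-tu^3)\,x_{-3a-2b}(-2t^2u^3)$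 9. $[x_{-a-b}(u),x_{-a}(t)]=x_{-2a-b}(2tu)\,x_{-3a-b}(3t^2u)\,x_{-3a-2b}(-3tu^2)$ 10. $[x_{-2a-b}(u),x_{-a}(t)]=x_{-3a-b}(3tu)$ 11. $[x_{-3a-b}(u),x_{-b}(t)]=x_{-3a-2b}(tu)$ 12. $[x_{-2a-b}(u),x_{-a-b}(t)]=x_{-3a-2b}(-3tu)$ Positive and negative roots: 13. $[x_{-a-b}(u),x_a(t)]=x_{-b}(3tu)$ 14. $[x_{-2a-b}(u),x_a(t)]=x_{-a-b}(2tu)\,x_{-b}(3t^2u)\,x_{-3a-2b}(3tu^2)$ 15. $[x_{-3a-b}(u),x_a(t)]=x_{-2a-b}(tu)\,x_{-a-b}(t^2u)\,x_{-b}(t^3u)\,x_{-3a-2b}(t^3u^2)$ 16. $[x_a(u),x_{-3a-b}(t)]=x_{-2a-b}(-tu)\,x_{-a-b}(-tu^2)\,x_{-b}(-tu^3)\,x_{-3a-2b}(2t^2u^3)$ 17. $[x_b(u),x_{-a-b}(t)]=x_{-a}(tu)\,x_{-2a-b}(-t^2u)\,x_{-3a-2b}(t^3u)\,x_{-3a-b}(-t^3u^2)$ 18. $[x_{-a-b}(u),x_b(t)]=x_{-a}(-tu)\,x_{-2a-b}(tu^2)\,x_{-3a-2b}(-tu^3)\,x_{-3a-b}(-2t^2u^3)$ 19. $[x_{-3a-2b}(u),x_b(t)]=x_{-3a-b}(tu)$ 20. $[x_{-a}(u),x_{a+b}(t)]=x_b(3tu)$ 21. $[x_{-b}(u),x_{a+b}(t)]=x_a(-tu)\,x_{2a+b}(-t^2u)\,x_{3a+2b}(-t^3u)\,x_{3a+b}(-t^3u^2)$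 22. $[x_{a+b}(u),x_{-b}(t)]=x_a(tu)\,x_{2a+b}(tu^2)\,x_{3a+2b}(tu^3)\,x_{3a+b}(-2t^2u^3)$ 23. $[x_{-2a-b}(u),x_{a+b}(t)]=x_{-a}(-2tu)\,x_b(-3t^2u)\,x_{-3a-b}(3tu^2)$ 24. $[x_{-3a-2b}(u),x_{a+b}(t)]=x_{-2a-b}(-tu)\,x_{-a}(t^2u)\,x_b(t^3u)\,x_{-3a-b}(t^3u^2)$ 25. $[x_{a+b}(u),x_{-3a-2b}(t)]=x_{-2a-b}(tu)\,x_{-a}(-tu^2)\,x_b(-tu^3)\,x_{-3a-b}(2t^2u^3)$ 26. $[x_{-a}(u),x_{2a+b}(t)]=x_{a+b}(2tu)\,x_{3a+2b}(-3t^2u)\,x_b(-3tu^2)$ 27. $[x_{-a-b}(u),x_{2a+b}(t)]=x_a(-2tu)\,x_{3a+b}(-3t^2u)\,x_{-b}(3tu^2)$ 28. $[x_{-3a-b}(u),x_{2a+b}(t)]=x_{-a}(-tu)\,x_{a+b}(-t^2u)\,x_{3a+2b}(t^3u)\,x_b(-t^3u^2)$ 29. $[x_{2a+b}(u),x_{-3a-b}(t)]=x_{-a}(tu)\,x_{a+b}(tu^2)\,x_{3a+2b}(-tu^3)\,x_b(-2t^2u^3)$ 30. $[x_{-3a-2b}(u),x_{2a+b}(t)]=x_{-a-b}(tu)\,x_a(-t^2u)\,x_{3a+b}(-t^3u)\,x_{-b}(t^3u^2)$ 31. $[x_{2a+b}(u),x_{-3a-2b}(t)]=x_{-a-b}(-tu)\,x_a(tu^2)\,x_{3a+b}(tu^3)\,x_{-b}(2t^2u^3)$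 32. $[x_{-a}(u),x_{3a+b}(t)]=x_{2a+b}(tu)\,x_{a+b}(-tu^2)\,x_b(tu^3)\,x_{3a+2b}(2t^2u^3)$ 33. $[x_{3a+b}(u),x_{-a}(t)]=x_{2a+b}(-tu)\,x_{a+b}(t^2u)\,x_b(-t^3u)\,x_{3a+2b}(t^3u^2)$ 34. $[x_{-2a-b}(u),x_{3a+b}(t)]=x_a(-tu)\,x_{-a-b}(tu^2)\,x_{-3a-2b}(tu^3)\,x_{-b}(-2t^2u^3)$ 35. $[x_{3a+b}(u),x_{-2a-b}(t)]=x_a(tu)\,x_{-a-b}(-t^2u)\,x_{-3a-2b}(-t^3u)\,x_{-b}(-t^3u^2)$ 36. $[x_{-3a-2b}(u),x_{3a+b}(t)]=x_{-b}(-tu)$ 37. $[x_{-a-b}(u),x_{3a+2b}(t)]=x_{2a+b}(-tu)\,x_a(-tu^2)\,x_{-b}(tu^3)\,x_{3a+b}(2t^2u^3)$ 38. $[x_{3a+2b}(u),x_{-a-b}(t)]=x_{2a+b}(tu)\,x_a(t^2u)\,x_{-b}(-t^3u)\,x_{3a+b}(t^3u^2)$ 39. $[x_{-2a-b}(u),x_{3a+2b}(t)]=x_{a+b}(tu)\,x_{-a}(tu^2)\,x_{-3a-b}(-tu^3)\,x_b(2t^2u^3)$ 40. $[x_{3a+2b}(u),x_{-2a-b}(t)]=x_{a+b}(-tu)\,x_{-a}(-t^2u)\,x_{-3a-b}(t^3u)\,x_b(t^3u^2)$ 41. $[x_{-3a-b}(u),x_{3a+2b}(t)]=x_b(-tu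)$
   Context: Root system: in Euclidean $\mathbb{R}^3$ with orthonormal basis $\varepsilon_1,\varepsilon_2,\varepsilon_3$ put $a=\varepsilon_1-\varepsilon_2$, $b=-2\varepsilon_1+\varepsilon_2+\varepsilon_3$, so $(a,a)=2$, $(b,b)=6$, $(a,b)=-3$. The root system $\Phi$ of type $G_2$ is $\{\pm a,\pm b,\pm(a+b),\pm(2a+b),\pm(3a+b),\pm(3a+2b)\}$, with fundamental roots $a,b$. The pairs $(a,b),(a,a+b),(a,2a+b),(b,3a+b)$ are the extraspecial pairs of roots for the ordering $a\prec b\prec a+b\prec 2a+b\prec 3a+b\prec 3a+2b$. Structure constants: the complex simple Lie algebra $L$ of type $G_2$ has a Chevalley basis $\{h_a,h_b\}\cup\{e_r: r\in\Phi\}$, where $[h_r,h_s]=0$, $[h_r,e_s]=\frac{2(r,s)}{(r,r)}e_s$, $[e_r,e_{-r}]=h_r$ (with $h_r$ the coroot element of $r$, an integer combination of $h_a,h_b$), $[e_r,e_s]=N_{r,s}e_{r+s}$ if $r,s,r+s\in\Phi$, and $[e_r,e_s]=0$ if $r+s\notin\Phi\cup\{0\}$. For a Chevalley basis $N_{-r,-s}=-N_{r,s}$ and $N_{r,s}=\pm(p+1)$ when $r,s,r+s\in\Phi$, where $p$ is the largest integer with $s-pr\in\Phi$. So positivity on the extraspecial pairs means $N_{a,b}=1$, $N_{a,a+b}=2$, $N_{a,2a+b}=3$, $N_{b,3a+b}=1$. Chevalley group: let $L_{\mathbb{Z}}$ be the $\mathbb{Z}$-span of the Chevalley basis and $L_K=K\otimes_{\mathbb{Z}}L_{\mathbb{Z}}$.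 The maps $\frac{1}{k!}(\mathrm{ad}\,e_r)^k$ preserve $L_{\mathbb{Z}}$, and $x_r(t)=\exp(t\,\mathrm{ad}\,e_r)=\sum_{k\ge 0}t^k\frac{(\mathrm{ad}\,e_r)^k}{k!}$ is the resulting automorphism of $L_K$. Automorphisms act on the left and products are compositions. The Chevalley group of type $G_2$ over $K$ is generated by all $x_r(t)$. *)

theory Defs
  imports "HOL-Analysis.Analysis" "HOL-Library.Groups_Big_Fun"
begin

section \<open>The root system of type \<open>G\<^sub>2\<close>\<close>

definition \<alpha> :: "real^3" where
  "\<alpha> = axis 1 1 - axis 2 1"

definition \<beta> :: "real^3" where
  "\<beta> = - 2 *\<^sub>R axis 1 1 + axis 2 1 + axis 3 1"

definition G2_roots :: "(real^3) set" where
  "G2_roots = (let P = {\<alpha>, \<beta>, \<alpha> + \<beta>, 2 *\<^sub>R \<alpha> + \<beta>, 3 *\<^sub>R \<alpha> + \<beta>, 3 *\<^sub>R \<alpha> + 2 *\<^sub>R \<beta>}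
               in P \<union> uminus ` P)"

definition coroot :: "real^3 \<Rightarrow> real^3" where
  "coroot r = (2 / (r \<bullet> r)) *\<^sub>R r"

definition cartan_number :: "real^3 \<Rightarrow> real^3 \<Rightarrow> real" where
  "cartan_number r s = 2 * (r \<bullet> s) / (r \<bullet> r)"

text \<open>The largest integer \<open>p\<close> with \<open>s - p r\<close> a root; used only for linearly independent
  roots \<open>r\<close>, \<open>s\<close>, where it exists.\<close>

definition string_length :: "real^3 \<Rightarrow> real^3 \<Rightarrow> int" where
  "string_length r s = (GREATEST p :: int. s - of_int p *\<^sub>R r \<in> G2_roots)"

text \<open>Index type of a Chevalley basis: one index for each of the two fundamental coroots and
  one for each of the twelve roots.\<close>

typedef G2_root = G2_roots
  by (auto simp: G2_roots_def Let_def)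

datatype G2_index = Ha | Hb | E G2_root

instance G2_root :: finite
proof
  have "finite G2_roots"
    by (simp add: G2_roots_def Let_def)
  then show "finite (UNIV :: G2_root set)"
    by (metis type_definition.univ[OF type_definition_G2_root] finite_imageI)
qed

instance G2_index :: finite
proof
  have "(UNIV :: G2_index set) = {Ha, Hb} \<union> range E"
    using G2_index.exhaust by auto
  then show "finite (UNIV :: G2_index set)"
    by (metis finite.emptyI finite.insertI finite_UnI finite_imageI finite)
qed

section \<open>Chevalley bases of the complex simple Lie algebra of type \<open>G\<^sub>2\<close>\<close>

locale lie_algebra = vector_space scale
  for scale :: "'f::field \<Rightarrow> 'l::ab_group_add \<Rightarrow> 'l" +
  fixes bracket :: "'l \<Rightarrow> 'l \<Rightarrow> 'l"
  assumes linear_left: "Vector_Spaces.linear scale scale (\<lambda>x. bracket x y)"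
    and linear_right: "Vector_Spaces.linear scale scale (\<lambda>y. bracket x y)"
    and alternating: "bracket x x = 0"
    and jacobi:
      "bracket x (bracket y z) + bracket y (bracket z x) + bracket z (bracket x y) = 0"
begin

definition lie_ideal :: "'l set \<Rightarrow> bool" where
  "lie_ideal I \<longleftrightarrow> subspace I \<and> (\<forall>x. \<forall>y\<in>I. bracket x y \<in> I)"

end

locale simple_lie_algebra = lie_algebra +
  assumes nonabelian: "\<exists>x y. bracket x y \<noteq> 0"
    and simple: "lie_ideal I \<Longrightarrow> I = {0} \<or> I = UNIV"

fun basis_family :: "(real^3 \<Rightarrow> 'l) \<Rightarrow> (real^3 \<Rightarrow> 'l) \<Rightarrow> G2_index \<Rightarrow> 'l" where
  "basis_family h e Ha = h \<alpha>"
| "basis_family h e Hb = h \<beta>"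
| "basis_family h e (E r) = e (Rep_G2_root r)"

text \<open>The values of \<open>h\<close> and \<open>e\<close> off the roots, and those of \<open>N\<close> on pairs of roots
  whose sum is not a root, are irrelevant.\<close>

locale G2_chevalley_basis = simple_lie_algebra scale bracket
  for scale :: "complex \<Rightarrow> 'l::ab_group_add \<Rightarrow> 'l" and bracket :: "'l \<Rightarrow> 'l \<Rightarrow> 'l" +
  fixes h e :: "real^3 \<Rightarrow> 'l" and N :: "real^3 \<Rightarrow> real^3 \<Rightarrow> int"
  assumes basis_inj: "inj (basis_family h e)"
    and basis_independent: "independent (range (basis_family h e))"
    and basis_span: "span (range (basis_family h e)) = UNIV"
    and h_coroot: "\<And>m n :: int. r \<in> G2_roots \<Longrightarrow>
      coroot r = of_int m *\<^sub>R coroot \<alpha> + of_int n *\<^sub>R coroot \<beta> \<Longrightarrow>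
      h r = scale (of_int m) (h \<alpha>) + scale (of_int n) (h \<beta>)"
    and bracket_h_h: "r \<in> G2_roots \<Longrightarrow> s \<in> G2_roots \<Longrightarrow> bracket (h r) (h s) = 0"
    and bracket_h_e: "r \<in> G2_roots \<Longrightarrow> s \<in> G2_roots \<Longrightarrow>
      bracket (h r) (e s) = scale (of_real (cartan_number r s)) (e s)"
    and bracket_e_neg: "r \<in> G2_roots \<Longrightarrow> bracket (e r) (e (- r)) = h r"
    and bracket_e_e: "r \<in> G2_roots \<Longrightarrow> s \<in> G2_roots \<Longrightarrow> r + s \<in> G2_roots \<Longrightarrow>
      bracket (e r) (e s) = scale (of_int (N r s)) (e (r + s))"
    and bracket_e_e_0: "r \<in> G2_roots \<Longrightarrow> s \<in> G2_roots \<Longrightarrow> r + s \<notin> G2_roots \<union> {0} \<Longrightarrow>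
      bracket (e r) (e s) = 0"
    and N_neg: "r \<in> G2_roots \<Longrightarrow> s \<in> G2_roots \<Longrightarrow> r + s \<in> G2_roots \<Longrightarrow>
      N (- r) (- s) = - N r s"
    and N_abs: "r \<in> G2_roots \<Longrightarrow> s \<in> G2_roots \<Longrightarrow> r + s \<in> G2_roots \<Longrightarrow>
      \<bar>N r s\<bar> = string_length r s + 1"

section \<open>Root elements over a commutative ring\<close>

text \<open>\<open>L\<^sub>K = K \<otimes> L\<^sub>\<int>\<close> is the free \<open>K\<close>-module on the Chevalley basis; the function \<open>v\<close>
  stands for the sum of the \<open>v i \<otimes> basis_family h e i\<close>.\<close>

type_synonym 'k L_over = "G2_index \<Rightarrow> 'k"

context G2_chevalley_basis
begin

definition int_coords :: "'l \<Rightarrow> G2_index \<Rightarrow> int" where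
  "int_coords y = (THE c. y = (\<Sum>i\<in>UNIV. scale (of_int (c i)) (basis_family h e i)))"

text \<open>The map \<open>1 \<otimes> f\<close> on \<open>L\<^sub>K\<close>, for a linear map \<open>f\<close> preserving \<open>L\<^sub>\<int>\<close>.\<close>

definition base_change :: "('l \<Rightarrow> 'l) \<Rightarrow> 'k::comm_ring_1 L_over \<Rightarrow> 'k L_over" where
  "base_change f v = (\<lambda>i. \<Sum>j\<in>UNIV. of_int (int_coords (f (basis_family h e j)) i) * v j)"

definition ad_divided_power :: "real^3 \<Rightarrow> nat \<Rightarrow> 'l \<Rightarrow> 'l" where
  "ad_divided_power r k y = scale (1 / fact k) ((bracket (e r) ^^ k) y)"

text \<open>\<^const>\<open>Sum_any\<close> is a sum with finitely many nonzero terms, since \<open>ad e\<^sub>r\<close> is nilpotent.\<close>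

definition root_element :: "real^3 \<Rightarrow> 'k::comm_ring_1 \<Rightarrow> 'k L_over \<Rightarrow> 'k L_over" where
  "root_element r t v = (\<lambda>i. Sum_any (\<lambda>k. t ^ k * base_change (ad_divided_power r k) v i))"

end

definition commutator :: "('m \<Rightarrow> 'm) \<Rightarrow> ('m \<Rightarrow> 'm) \<Rightarrow> 'm \<Rightarrow> 'm" where
  "commutator x y = inv x \<circ> inv y \<circ> x \<circ> y"

end

(*
  The four extraspecial structure constants are p + 1 by positivity. The Jacobi identity for
  triples of roots with sum zero, and for a, b, 2a+b, then yields all the others. So the action
  of each ad e_r on the integral lattice is explicit; its divided powers vanish from the fourth
  one on, which gives x_r(t) as an explicit 14 x 14 matrix over K. A commutator identity
  [x, y] = z is equivalent to xy = yxz, and this is checked on coordinates, where it becomes a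
  family of polynomial identities.
*)

theory Submission
  imports Defs
begin

section \<open>Roots and structure constants\<close>

text \<open>The obstacle is that K is only a commutative ring, where 2 and 3 may be zero: the
  factors 1/2! and 1/3! of the exponential have no meaning over K. They must be absorbed over the
  integers, before the base change. This is why each \<open>ad e_r\<close> is turned into a map on
  lists of 14 integers: its iterates on the unit vectors are computed there, divided exactly by 2
  and 6, and only the quotients are sent to K. The resulting matrices have entries that are integer
  polynomials in the parameter, so the final identities hold over every commutative ring by ring
  normalisation alone.

  Real vectors would obstruct such computations. Roots are therefore written as
  \<open>rt m n\<close>, with integer coefficients along \<alpha> and \<beta>; sums, membership in
  the root system, Cartan numbers and root strings then become arithmetic on numerals.\<close>

definition rt :: "int \<Rightarrow> int \<Rightarrow> real^3" where
  "rt m n = of_int m *\<^sub>R \<alpha> + of_int n *\<^sub>R \<beta>"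

lemma rt_nth: "rt m n $ 1 = of_int m - 2 * of_int n" "rt m n $ 3 = of_int n"
  by (simp_all add: rt_def \<alpha>_def \<beta>_def axis_def)

text \<open>Two Euclidean coordinates are enough: the third one is n, and the first one then gives
  m.\<close>

lemma rt_eq_iff [simp]: "rt m n = rt m' n' \<longleftrightarrow> m = m' \<and> n = n'"
proof
  assume "rt m n = rt m' n'"
  then have "rt m n $ 1 = rt m' n' $ 1" "rt m n $ 3 = rt m' n' $ 3"
    by simp_all
  then show "m = m' \<and> n = n'"
    by (simp add: rt_nth)
qed simp

lemma rt_add [simp]: "rt m n + rt m' n' = rt (m + m') (n + n')"
  and rt_minus [simp]: "- rt m n = rt (- m) (- n)"
  by (simp_all add: rt_def algebra_simps)

lemma diff_rt [simp]: "rt m n - rt m' n' = rt (m - m') (n - n')"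
  and scaleR_rt: "of_int p *\<^sub>R rt m n = rt (p * m) (p * n)"
  by (simp_all add: rt_def algebra_simps)

lemma zero_eq_rt: "0 = rt 0 0"
  by (simp add: rt_def)

lemma rt_eq_0_iff [simp]: "rt m n = 0 \<longleftrightarrow> m = 0 \<and> n = 0"
  unfolding zero_eq_rt by simp

lemma alpha_rt: "\<alpha> = rt 1 0" and beta_rt: "\<beta> = rt 0 1"
  by (simp_all add: rt_def)

lemma inner_rt: "rt m n \<bullet> rt m' n' = of_int (2 * m * m' - 3 * (m * n' + n * m') + 6 * n * n')"
proof -
  have "\<alpha> \<bullet> \<alpha> = 2" "\<alpha> \<bullet> \<beta> = - 3" "\<beta> \<bullet> \<alpha> = - 3" "\<beta> \<bullet> \<beta> = 6"
    by (simp_all add: \<alpha>_def \<beta>_def inner_vec_def sum_3 axis_def)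
  then show ?thesis
    by (simp add: rt_def inner_add_left inner_add_right algebra_simps)
qed

lemma G2_roots_rt:
  "G2_roots = (\<lambda>(m, n). rt m n) ` {(1, 0), (0, 1), (1, 1), (2, 1), (3, 1), (3, 2),
    (- 1, 0), (0, - 1), (- 1, - 1), (- 2, - 1), (- 3, - 1), (- 3, - 2)}"
proof -
  have "\<alpha> + \<beta> = rt 1 1" "2 *\<^sub>R \<alpha> + \<beta> = rt 2 1" "3 *\<^sub>R \<alpha> + \<beta> = rt 3 1"
      "3 *\<^sub>R \<alpha> + 2 *\<^sub>R \<beta> = rt 3 2"
    by (simp_all add: rt_def)
  then show ?thesis
    unfolding G2_roots_def Let_def by (simp add: alpha_rt beta_rt insert_commute)
qed

text \<open>As a simp rule this decides membership whenever m and n are numerals. With symbolic m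
  and n it produces a twelvefold disjunction, so general lemmas switch it off.\<close>

lemma rt_in_G2_roots [simp]: "rt m n \<in> G2_roots \<longleftrightarrow>
  (m, n) \<in> {(1, 0), (0, 1), (1, 1), (2, 1), (3, 1), (3, 2),
    (- 1, 0), (0, - 1), (- 1, - 1), (- 2, - 1), (- 3, - 1), (- 3, - 2)}"
  unfolding G2_roots_rt by auto

lemma cartan_number_rt: "cartan_number (rt m n) (rt m' n') =
    of_int (2 * (2 * m * m' - 3 * (m * n' + n * m') + 6 * n * n')) /
    of_int (2 * m * m - 6 * m * n + 6 * n * n)"
  by (simp add: cartan_number_def inner_rt algebra_simps)

text \<open>For roots the divisions in \<open>coroot_a\<close> and \<open>coroot_b\<close> are exact.\<close>

definition coroot_a :: "int \<Rightarrow> int \<Rightarrow> int" where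
  "coroot_a m n = 2 * m div (2 * m * m - 6 * m * n + 6 * n * n)"

definition coroot_b :: "int \<Rightarrow> int \<Rightarrow> int" where
  "coroot_b m n = 6 * n div (2 * m * m - 6 * m * n + 6 * n * n)"

text \<open>Short roots have squared length 2 and long roots 6, so the coroot of \<alpha> is
  \<alpha> itself and that of \<beta> is \<beta>/3. Hence 2r/(r,r) has coefficients 2m/(r,r) and
  6n/(r,r) with respect to these two coroots.\<close>

lemma coroot_rt:
  assumes "rt m n \<in> G2_roots"
  shows "coroot (rt m n) = of_int (coroot_a m n) *\<^sub>R coroot \<alpha> + of_int (coroot_b m n) *\<^sub>R coroot \<beta>"
proof -
  have "coroot (rt m n) = (2 / of_int (2 * m * m - 6 * m * n + 6 * n * n)) *\<^sub>R rt m n" for m n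
    by (simp add: coroot_def inner_rt algebra_simps)
  moreover have "coroot \<alpha> = \<alpha>" "coroot \<beta> = (1/3) *\<^sub>R \<beta>"
    by (simp_all add: coroot_def alpha_rt beta_rt inner_rt)
  ultimately show ?thesis
    using assms unfolding rt_in_G2_roots
    by (elim insertE emptyE) (simp_all add: coroot_a_def coroot_b_def,
        simp_all add: rt_def scaleR_right_distrib scaleR_right_diff_distrib)
qed

text \<open>\<open>GREATEST\<close> over the integers has a usable value only when a maximum is
  attained. The bound on q is phrased with \<open>rt\<close>, so that it becomes linear
  arithmetic.\<close>

lemma string_length_rt:
  assumes "rt m' n' - of_int p *\<^sub>R rt m n \<in> G2_roots"
    and "\<And>q. rt (m' - q * m) (n' - q * n) \<in> G2_roots \<Longrightarrow> q \<le> p"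
  shows "string_length (rt m n) (rt m' n') = p"
proof -
  have "rt m' n' - of_int q *\<^sub>R rt m n = rt (m' - q * m) (n' - q * n)" for q
    by (simp add: rt_def algebra_simps)
  then show ?thesis
    using assms unfolding string_length_def by (intro Greatest_equality) auto
qed

section \<open>Relations forced by antisymmetry and the Jacobi identity\<close>

context G2_chevalley_basis
begin

lemma h_rt:
  assumes "rt m n \<in> G2_roots"
  shows "h (rt m n) = scale (of_int (coroot_a m n)) (h \<alpha>) + scale (of_int (coroot_b m n)) (h \<beta>)"
  using assms by (intro h_coroot coroot_rt)

lemma h_independent:
  assumes "scale c (h \<alpha>) + scale d (h \<beta>) = 0"
  shows "c = 0" "d = 0"
proof -
  \<comment> \<open>Without distinctness the coefficient function
    \<open>if v = h \<alpha> then c else d\<close> could not carry both c and d.\<close>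
  have ne: "h \<alpha> \<noteq> h \<beta>"
    using basis_inj unfolding inj_def by (metis basis_family.simps(1,2) G2_index.distinct(1))
  have "independent {h \<alpha>, h \<beta>}"
  proof (rule independent_mono[OF basis_independent])
    show "{h \<alpha>, h \<beta>} \<subseteq> range (basis_family h e)"
      using basis_family.simps(1,2)[of h e] by (metis empty_subsetI insert_subset rangeI)
  qed
  then have "(if v = h \<alpha> then c else d) = 0" if "v \<in> {h \<alpha>, h \<beta>}" for v
    using independentD[of "{h \<alpha>, h \<beta>}" "{h \<alpha>, h \<beta>}" "\<lambda>v. if v = h \<alpha> then c else d" v] that assms ne
    by auto
  from this[of "h \<alpha>"] this[of "h \<beta>"] ne show "c = 0" "d = 0" by auto
qed

lemma bracket_add_left: "bracket (x + y) z = bracket x z + bracket y z"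
  and bracket_add_right: "bracket z (x + y) = bracket z x + bracket z y"
  and bracket_scale_right: "bracket z (scale c x) = scale c (bracket z x)"
  using linear_left[of z] linear_right[of z]
  unfolding Vector_Spaces.linear_def module_hom_iff by blast+

lemma bracket_0_right: "bracket z 0 = 0"
  using bracket_scale_right[of z 0 0] by simp

lemma bracket_antisym: "bracket x y = - bracket y x"
proof -
  have "bracket (x + y) (x + y) = bracket x y + bracket y x"
    unfolding bracket_add_left bracket_add_right by (simp add: alternating)
  then have "bracket x y + bracket y x = 0"
    by (simp add: alternating)
  then show ?thesis
    by (rule eq_neg_iff_add_eq_0[THEN iffD2])
qed

lemma e_nonzero:
  assumes "r \<in> G2_roots"
  shows "e r \<noteq> 0"
proof -
  have "e r \<in> range (basis_family h e)"
    using assms basis_family.simps(3)[of h e "Abs_G2_root r"] by (metis Abs_G2_root_inverse rangeI)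
  then show ?thesis
    using basis_independent dependent_zero by metis
qed

lemma N_antisym:
  assumes "r \<in> G2_roots" "s \<in> G2_roots" "r + s \<in> G2_roots"
  shows "N s r = - N r s"
proof -
  have "scale (of_int (N s r)) (e (r + s)) = bracket (e s) (e r)"
    using bracket_e_e[of s r] assms by (simp add: add.commute)
  also have "\<dots> = - bracket (e r) (e s)"
    by (rule bracket_antisym)
  also have "\<dots> = scale (of_int (- N r s)) (e (r + s))"
    using bracket_e_e[of r s] assms by simp
  finally show ?thesis
    using e_nonzero[OF assms(3)] by (metis scale_right_imp_eq of_int_eq_iff)
qed

lemma rt_minus_in_G2_roots: "rt m n \<in> G2_roots \<Longrightarrow> rt (- m) (- n) \<in> G2_roots"
  unfolding rt_in_G2_roots by (elim insertE emptyE) simp_all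

text \<open>The Jacobi identity for \<open>e\<^sub>r, e\<^sub>s, e\<^sub>t\<close> with \<open>r + s + t = 0\<close> is a linear relation between
  \<open>h\<^sub>r, h\<^sub>s, h\<^sub>t\<close>; comparing coordinates determines \<open>N\<^bsub>s,t\<^esub>\<close> and \<open>N\<^bsub>t,r\<^esub>\<close> from \<open>N\<^bsub>r,s\<^esub>\<close>.\<close>

lemma N_triple:
  assumes "rt m n \<in> G2_roots" "rt m' n' \<in> G2_roots" "rt (m + m') (n + n') \<in> G2_roots"
  defines "r \<equiv> rt m n" and "s \<equiv> rt m' n'" and "t \<equiv> rt (- (m + m')) (- (n + n'))"
  shows "N s t * coroot_a m n + N t r * coroot_a m' n' + N r s * coroot_a (- (m + m')) (- (n + n')) = 0"
    and "N s t * coroot_b m n + N t r * coroot_b m' n' + N r s * coroot_b (- (m + m')) (- (n + n')) = 0"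
proof -
  note [simp del] = rt_in_G2_roots
  \<comment> \<open>Since the three roots sum to zero, each inner bracket in the Jacobi identity is
    a multiple of the root vector opposite to the outer one, and the outer bracket yields a coroot
    element.\<close>
  have sums: "r + s = - t" "s + t = - r" "t + r = - s"
    by (simp_all add: r_def s_def t_def)
  have roots: "r \<in> G2_roots" "s \<in> G2_roots" "t \<in> G2_roots"
      "- r \<in> G2_roots" "- s \<in> G2_roots" "- t \<in> G2_roots"
    using assms(1-3) assms(1-3)[THEN rt_minus_in_G2_roots] by (simp_all add: add.commute r_def s_def t_def)
  have "bracket (e r) (bracket (e s) (e t)) = scale (of_int (N s t)) (h r)"
    using bracket_e_e[of s t] roots sums by (simp add: bracket_scale_right bracket_e_neg)
  moreover have "bracket (e s) (bracket (e t) (e r)) = scale (of_int (N t r)) (h s)"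
    using bracket_e_e[of t r] roots sums by (simp add: bracket_scale_right bracket_e_neg)
  moreover have "bracket (e t) (bracket (e r) (e s)) = scale (of_int (N r s)) (h t)"
    using bracket_e_e[of r s] roots sums by (simp add: bracket_scale_right bracket_e_neg)
  ultimately have "scale (of_int (N s t)) (h r) + scale (of_int (N t r)) (h s) + scale (of_int (N r s)) (h t) = 0"
    using jacobi[of "e r" "e s" "e t"] by simp
  moreover note h_rt[OF roots(1)[unfolded r_def], folded r_def]
    h_rt[OF roots(2)[unfolded s_def], folded s_def] h_rt[OF roots(3)[unfolded t_def], folded t_def]
  ultimately have "scale (of_int (N s t * coroot_a m n + N t r * coroot_a m' n' +
        N r s * coroot_a (- (m + m')) (- (n + n')))) (h \<alpha>) +
    scale (of_int (N s t * coroot_b m n + N t r * coroot_b m' n' +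
        N r s * coroot_b (- (m + m')) (- (n + n')))) (h \<beta>) = 0"
    by (simp add: scale_left_distrib scale_right_distrib ac_simps del: minus_add_distrib)
  from h_independent[OF this]
  show "N s t * coroot_a m n + N t r * coroot_a m' n' + N r s * coroot_a (- (m + m')) (- (n + n')) = 0"
    and "N s t * coroot_b m n + N t r * coroot_b m' n' + N r s * coroot_b (- (m + m')) (- (n + n')) = 0"
    by (simp_all only: of_int_eq_0_iff)
qed

end

text \<open>The sign choice is isolated here: everything proved in \<open>G2_chevalley_basis\<close>
  is valid for any choice of signs.\<close>

locale G2_positive_basis = G2_chevalley_basis +
  assumes pos: "N \<alpha> \<beta> > 0" "N \<alpha> (\<alpha> + \<beta>) > 0" "N \<alpha> (2 *\<^sub>R \<alpha> + \<beta>) > 0" "N \<beta> (3 *\<^sub>R \<alpha> + \<beta>) > 0"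
begin

lemma N_extraspecial:
  "N (rt 1 0) (rt 0 1) = 1" "N (rt 1 0) (rt 1 1) = 2" "N (rt 1 0) (rt 2 1) = 3"
  "N (rt 0 1) (rt 3 1) = 1"
proof -
  have pos: "N (rt 1 0) (rt 0 1) > 0" "N (rt 1 0) (rt 1 1) > 0" "N (rt 1 0) (rt 2 1) > 0"
    "N (rt 0 1) (rt 3 1) > 0"
    using pos by (simp_all add: rt_def)
  \<comment> \<open>In the a-string b, a+b, 2a+b, 3a+b the first three members are preceded by 0, 1
    and 2 roots; in the last case 3a is not a root.\<close>
  have "string_length (rt 1 0) (rt 0 1) = 0" "string_length (rt 1 0) (rt 1 1) = 1"
    "string_length (rt 1 0) (rt 2 1) = 2" "string_length (rt 0 1) (rt 3 1) = 0"
    \<comment> \<open>The deleted rules would evaluate \<open>of_int p\<close> for a numeral p, and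
      \<open>scaleR_rt\<close> would no longer match.\<close>
    by (rule string_length_rt; (simp add: scaleR_rt del: of_int_0 of_int_1 of_int_numeral)?; linarith?)+
  then show "N (rt 1 0) (rt 0 1) = 1" "N (rt 1 0) (rt 1 1) = 2" "N (rt 1 0) (rt 2 1) = 3"
  "N (rt 0 1) (rt 3 1) = 1"
    using pos N_abs[of "rt 1 0" "rt 0 1"] N_abs[of "rt 1 0" "rt 1 1"] N_abs[of "rt 1 0" "rt 2 1"]
     N_abs[of "rt 0 1" "rt 3 1"] by simp_all
qed

text \<open>3a+2b is the only positive root with two decompositions into positive roots, b+(3a+b)
  and (a+b)+(2a+b), and the second pair is not extraspecial. The Jacobi identity for a, b, 2a+b
  compares them: 2a+2b is not a root, so one term vanishes and the two others are multiples of the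
  root vector of 3a+2b.\<close>

lemma N_special: "N (rt 1 1) (rt 2 1) = - 3"
proof -
  have "bracket (e (rt 0 1)) (e (rt 2 1)) = 0"
    by (rule bracket_e_e_0) simp_all
  moreover have "bracket (e (rt 2 1)) (e (rt 1 0)) = scale (- 3) (e (rt 3 1))"
    using bracket_e_e[of "rt 1 0" "rt 2 1"] N_extraspecial bracket_antisym[of "e (rt 2 1)"] by simp
  moreover have "bracket (e (rt 0 1)) (e (rt 3 1)) = e (rt 3 2)"
    using bracket_e_e[of "rt 0 1" "rt 3 1"] N_extraspecial by simp
  moreover have "bracket (e (rt 1 0)) (e (rt 0 1)) = e (rt 1 1)"
    using bracket_e_e[of "rt 1 0" "rt 0 1"] N_extraspecial by simp
  moreover have "bracket (e (rt 2 1)) (e (rt 1 1)) = scale (of_int (N (rt 2 1) (rt 1 1))) (e (rt 3 2))"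
    using bracket_e_e[of "rt 2 1" "rt 1 1"] by simp
  ultimately have "scale (- 3) (e (rt 3 2)) + scale (of_int (N (rt 2 1) (rt 1 1))) (e (rt 3 2)) = 0"
    using jacobi[of "e (rt 1 0)" "e (rt 0 1)" "e (rt 2 1)"]
    by (simp add: bracket_scale_right bracket_0_right del: scale_minus_left)
  then have "scale (of_int (N (rt 2 1) (rt 1 1) - 3)) (e (rt 3 2)) = 0"
    by (simp add: scale_left_diff_distrib)
  then have "N (rt 2 1) (rt 1 1) = 3"
    using e_nonzero[of "rt 3 2"] by (simp del: of_int_diff)
  then show ?thesis
    using N_antisym[of "rt 2 1" "rt 1 1"] by simp
qed

text \<open>For r+s+t=0 the relation r+s+t=0, rewritten in coroots, has coefficients (r,r), (s,s),
  (t,t), and up to a factor it is the only one. So N_{s,t}, N_{t,r}, N_{r,s} are in the ratio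
  (r,r):(s,s):(t,t). The five instances are the pairs of positive roots whose sum is a root.\<close>

lemma N_cyclic:
  "N (rt 0 1) (rt (-1) (-1)) = 1"
  "N (rt (-1) (-1)) (rt 1 0) = 3"
  "N (rt 1 1) (rt (-2) (-1)) = 2"
  "N (rt (-2) (-1)) (rt 1 0) = 2"
  "N (rt 2 1) (rt (-3) (-1)) = 1"
  "N (rt (-3) (-1)) (rt 1 0) = 1"
  "N (rt 3 1) (rt (-3) (-2)) = 1"
  "N (rt (-3) (-2)) (rt 0 1) = 1"
  "N (rt 2 1) (rt (-3) (-2)) = -1"
  "N (rt (-3) (-2)) (rt 1 1) = -1"
  using N_extraspecial N_special
    N_triple[of 1 0 0 1]
    N_triple[of 1 0 1 1]
    N_triple[of 1 0 2 1]
    N_triple[of 0 1 3 1]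
    N_triple[of 1 1 2 1]
  by (simp_all add: coroot_a_def coroot_b_def)

lemma N_swap:
  "N (rt 1 0) (rt (-1) (-1)) = -3"
  "N (rt 1 0) (rt (-2) (-1)) = -2"
  "N (rt 1 0) (rt (-3) (-1)) = -1"
  "N (rt 0 1) (rt 1 0) = -1"
  "N (rt 0 1) (rt (-3) (-2)) = -1"
  "N (rt 1 1) (rt 1 0) = -2"
  "N (rt 1 1) (rt (-3) (-2)) = 1"
  "N (rt 2 1) (rt 1 0) = -3"
  "N (rt 2 1) (rt 1 1) = 3"
  "N (rt 3 1) (rt 0 1) = -1"
  "N (rt (-1) (-1)) (rt 0 1) = -1"
  "N (rt (-2) (-1)) (rt 1 1) = -2"
  "N (rt (-3) (-1)) (rt 2 1) = -1"
  "N (rt (-3) (-2)) (rt 2 1) = 1"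
  "N (rt (-3) (-2)) (rt 3 1) = -1"
  by (subst N_antisym; simp add: N_extraspecial N_special N_cyclic)+

lemma N_opposite:
  "N (rt 1 1) (rt (-1) 0) = -3"
  "N (rt 1 1) (rt 0 (-1)) = 1"
  "N (rt 2 1) (rt (-1) 0) = -2"
  "N (rt 2 1) (rt (-1) (-1)) = 2"
  "N (rt 3 1) (rt (-1) 0) = -1"
  "N (rt 3 1) (rt (-2) (-1)) = 1"
  "N (rt 3 2) (rt 0 (-1)) = -1"
  "N (rt 3 2) (rt (-1) (-1)) = 1"
  "N (rt 3 2) (rt (-2) (-1)) = -1"
  "N (rt 3 2) (rt (-3) (-1)) = 1"
  "N (rt (-1) 0) (rt 1 1) = 3"
  "N (rt (-1) 0) (rt 2 1) = 2"
  "N (rt (-1) 0) (rt 3 1) = 1"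
  "N (rt (-1) 0) (rt 0 (-1)) = -1"
  "N (rt (-1) 0) (rt (-1) (-1)) = -2"
  "N (rt (-1) 0) (rt (-2) (-1)) = -3"
  "N (rt 0 (-1)) (rt 1 1) = -1"
  "N (rt 0 (-1)) (rt 3 2) = 1"
  "N (rt 0 (-1)) (rt (-1) 0) = 1"
  "N (rt 0 (-1)) (rt (-3) (-1)) = -1"
  "N (rt (-1) (-1)) (rt 2 1) = -2"
  "N (rt (-1) (-1)) (rt 3 2) = -1"
  "N (rt (-1) (-1)) (rt (-1) 0) = 2"
  "N (rt (-1) (-1)) (rt (-2) (-1)) = 3"
  "N (rt (-2) (-1)) (rt 3 1) = -1"
  "N (rt (-2) (-1)) (rt 3 2) = 1"
  "N (rt (-2) (-1)) (rt (-1) 0) = 3"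
  "N (rt (-2) (-1)) (rt (-1) (-1)) = -3"
  "N (rt (-3) (-1)) (rt 3 2) = -1"
  "N (rt (-3) (-1)) (rt 0 (-1)) = 1"
  using N_neg[of "rt (-1) (-1)" "rt 1 0"]
    N_neg[of "rt (-1) (-1)" "rt 0 1"]
    N_neg[of "rt (-2) (-1)" "rt 1 0"]
    N_neg[of "rt (-2) (-1)" "rt 1 1"]
    N_neg[of "rt (-3) (-1)" "rt 1 0"]
    N_neg[of "rt (-3) (-1)" "rt 2 1"]
    N_neg[of "rt (-3) (-2)" "rt 0 1"]
    N_neg[of "rt (-3) (-2)" "rt 1 1"]
    N_neg[of "rt (-3) (-2)" "rt 2 1"]
    N_neg[of "rt (-3) (-2)" "rt 3 1"]
    N_neg[of "rt 1 0" "rt (-1) (-1)"]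
    N_neg[of "rt 1 0" "rt (-2) (-1)"]
    N_neg[of "rt 1 0" "rt (-3) (-1)"]
    N_neg[of "rt 1 0" "rt 0 1"]
    N_neg[of "rt 1 0" "rt 1 1"]
    N_neg[of "rt 1 0" "rt 2 1"]
    N_neg[of "rt 0 1" "rt (-1) (-1)"]
    N_neg[of "rt 0 1" "rt (-3) (-2)"]
    N_neg[of "rt 0 1" "rt 1 0"]
    N_neg[of "rt 0 1" "rt 3 1"]
    N_neg[of "rt 1 1" "rt (-2) (-1)"]
    N_neg[of "rt 1 1" "rt (-3) (-2)"]
    N_neg[of "rt 1 1" "rt 1 0"]
    N_neg[of "rt 1 1" "rt 2 1"]
    N_neg[of "rt 2 1" "rt (-3) (-1)"]
    N_neg[of "rt 2 1" "rt (-3) (-2)"]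
    N_neg[of "rt 2 1" "rt 1 0"]
    N_neg[of "rt 2 1" "rt 1 1"]
    N_neg[of "rt 3 1" "rt (-3) (-2)"]
    N_neg[of "rt 3 1" "rt 0 1"]
  by (simp_all add: N_extraspecial N_special N_cyclic N_swap)

text \<open>These are all sixty ordered pairs of roots with a root as sum: up to sign, three roots
  with sum zero are two positive roots and the negative of their sum. Each of the five such triples
  contributes six ordered pairs, and as many after negation.\<close>

lemmas N_values = N_extraspecial N_special N_cyclic N_swap N_opposite

end

section \<open>Root elements in coordinates\<close>

text \<open>All coordinate lists below follow the order of \<open>basis_list\<close>.\<close>

definition basis_list :: "G2_index list" where
  "basis_list = Ha # Hb # map (\<lambda>(m, n). E (Abs_G2_root (rt m n)))
    [(1, 0), (0, 1), (1, 1), (2, 1), (3, 1), (3, 2),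
     (- 1, 0), (0, - 1), (- 1, - 1), (- 2, - 1), (- 3, - 1), (- 3, - 2)]"

lemma length_basis_list [simp]: "length basis_list = 14"
  by (simp add: basis_list_def)

lemma distinct_basis_list: "distinct basis_list"
  by (simp add: basis_list_def Abs_G2_root_inject)

lemma set_basis_list: "set basis_list = UNIV"
proof -
  have "i \<in> set basis_list" for i
  proof (cases i)
    case (E r)
    then have "i = E (Abs_G2_root (Rep_G2_root r))"
      by (simp add: Rep_G2_root_inverse)
    then show ?thesis
      using Rep_G2_root[of r] unfolding G2_roots_rt by (auto simp: basis_list_def)
  qed (simp_all add: basis_list_def)
  then show ?thesis by blast
qed

lemma sum_UNIV_basis: "(\<Sum>i\<in>UNIV. f i) = (\<Sum>k<14. f (basis_list ! k))"
  using sum.distinct_set_conv_list[OF distinct_basis_list, of f]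
  by (simp add: set_basis_list sum_list_sum_nth lessThan_atLeast0)

text \<open>On a list shorter than the basis, \<open>the\<close> is applied to \<open>None\<close>
  for the missing indices; hence the length hypotheses in what follows.\<close>

definition from_list :: "'k list \<Rightarrow> 'k L_over" where
  "from_list vs i = the (map_of (zip basis_list vs) i)"

lemma from_list_nth [simp]:
  "length vs = 14 \<Longrightarrow> k < 14 \<Longrightarrow> from_list vs (basis_list ! k) = vs ! k"
  by (simp add: from_list_def map_of_zip_nth distinct_basis_list)

lemma basis_cases:
  obtains k where "k < 14" "i = basis_list ! k"
  using set_basis_list by (metis UNIV_I in_set_conv_nth length_basis_list)

text \<open>Replacing an arbitrary vector by a literal list of 14 variables lets identities between
  operators be checked by rewriting.\<close>

lemma from_list_cases:
  obtains v0 v1 v2 v3 v4 v5 v6 v7 v8 v9 v10 v11 v12 v13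
    where "v = from_list [v0, v1, v2, v3, v4, v5, v6, v7, v8, v9, v10, v11, v12, v13]"
proof -
  have "v = from_list (map v basis_list)"
  proof
    fix i show "v i = from_list (map v basis_list) i"
      by (rule basis_cases[of i]) simp
  qed
  then show ?thesis
    using that by (simp add: basis_list_def)
qed

lemma length_14E:
  assumes "length zs = 14"
  obtains z0 z1 z2 z3 z4 z5 z6 z7 z8 z9 z10 z11 z12 z13
    where "zs = [z0, z1, z2, z3, z4, z5, z6, z7, z8, z9, z10, z11, z12, z13]"
  using assms by (auto simp: numeral_eq_Suc length_Suc_conv)

definition unit_list :: "nat \<Rightarrow> int list" where
  "unit_list j = (replicate 14 0)[j := 1]"

text \<open>Index one appears as \<open>Suc 0\<close> because that is the form in which the
  simplifier leaves it when it expands sums over {..<14}.\<close>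

lemma unit_list_simps:
  "unit_list 0 = [1, 0, 0, 0, 0, 0, 0, 0, 0, 0, 0, 0, 0, 0]"
  "unit_list (Suc 0) = [0, 1, 0, 0, 0, 0, 0, 0, 0, 0, 0, 0, 0, 0]"
  "unit_list 2 = [0, 0, 1, 0, 0, 0, 0, 0, 0, 0, 0, 0, 0, 0]"
  "unit_list 3 = [0, 0, 0, 1, 0, 0, 0, 0, 0, 0, 0, 0, 0, 0]"
  "unit_list 4 = [0, 0, 0, 0, 1, 0, 0, 0, 0, 0, 0, 0, 0, 0]"
  "unit_list 5 = [0, 0, 0, 0, 0, 1, 0, 0, 0, 0, 0, 0, 0, 0]"
  "unit_list 6 = [0, 0, 0, 0, 0, 0, 1, 0, 0, 0, 0, 0, 0, 0]"
  "unit_list 7 = [0, 0, 0, 0, 0, 0, 0, 1, 0, 0, 0, 0, 0, 0]"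
  "unit_list 8 = [0, 0, 0, 0, 0, 0, 0, 0, 1, 0, 0, 0, 0, 0]"
  "unit_list 9 = [0, 0, 0, 0, 0, 0, 0, 0, 0, 1, 0, 0, 0, 0]"
  "unit_list 10 = [0, 0, 0, 0, 0, 0, 0, 0, 0, 0, 1, 0, 0, 0]"
  "unit_list 11 = [0, 0, 0, 0, 0, 0, 0, 0, 0, 0, 0, 1, 0, 0]"
  "unit_list 12 = [0, 0, 0, 0, 0, 0, 0, 0, 0, 0, 0, 0, 1, 0]"
  "unit_list 13 = [0, 0, 0, 0, 0, 0, 0, 0, 0, 0, 0, 0, 0, 1]"
  by (simp_all add: unit_list_def numeral_eq_Suc)

section \<open>Integer coordinates and the exponential series\<close>

context G2_chevalley_basis
begin

definition lincomb :: "int list \<Rightarrow> 'l" where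
  "lincomb zs = (\<Sum>i\<in>UNIV. scale (of_int (from_list zs i)) (basis_family h e i))"

lemma lincomb_nth:
  "length zs = 14 \<Longrightarrow> lincomb zs = (\<Sum>k<14. scale (of_int (zs ! k)) (basis_family h e (basis_list ! k)))"
  by (simp add: lincomb_def sum_UNIV_basis)

lemma lincomb_Cons:
  "lincomb [z0, z1, z2, z3, z4, z5, z6, z7, z8, z9, z10, z11, z12, z13] =
    scale (of_int z0) (h (rt 1 0)) + scale (of_int z1) (h (rt 0 1)) +
    scale (of_int z2) (e (rt 1 0)) + scale (of_int z3) (e (rt 0 1)) +
    scale (of_int z4) (e (rt 1 1)) + scale (of_int z5) (e (rt 2 1)) +
    scale (of_int z6) (e (rt 3 1)) + scale (of_int z7) (e (rt 3 2)) +
    scale (of_int z8) (e (rt (- 1) 0)) + scale (of_int z9) (e (rt 0 (- 1))) +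
    scale (of_int z10) (e (rt (- 1) (- 1))) + scale (of_int z11) (e (rt (- 2) (- 1))) +
    scale (of_int z12) (e (rt (- 3) (- 1))) + scale (of_int z13) (e (rt (- 3) (- 2)))"
  by (simp add: lincomb_nth basis_list_def lessThan_nat_numeral lessThan_Suc Abs_G2_root_inverse
      alpha_rt beta_rt ac_simps)

text \<open>\<open>independent\<close> speaks of a set, while coordinates are indexed by
  \<open>G2_index\<close>; injectivity of the family allows reindexing through
  \<open>inv\<close>.\<close>

lemma basis_independent_coeffs:
  assumes "(\<Sum>i\<in>UNIV. scale (c i) (basis_family h e i)) = 0"
  shows "c i = 0"
proof -
  let ?b = "basis_family h e"
  have "(\<Sum>v\<in>range ?b. scale (c (inv ?b v)) v) = 0"
    using assms by (simp add: sum.reindex[OF basis_inj] basis_inj)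
  then have "c (inv ?b (?b i)) = 0"
    by (intro independentD[OF basis_independent, where u = "\<lambda>v. c (inv ?b v)"]) auto
  then show ?thesis
    by (simp add: basis_inj)
qed

text \<open>The definite description is resolved by independence over the complex numbers, together
  with injectivity of \<open>of_int\<close> there.\<close>

lemma int_coords_lincomb: "int_coords (lincomb zs) = from_list zs"
  unfolding int_coords_def
proof (rule the_equality)
  show "lincomb zs = (\<Sum>i\<in>UNIV. scale (of_int (from_list zs i)) (basis_family h e i))"
    by (rule lincomb_def)
next
  fix c :: "G2_index \<Rightarrow> int"
  assume "lincomb zs = (\<Sum>i\<in>UNIV. scale (of_int (c i)) (basis_family h e i))"
  then have "(\<Sum>i\<in>UNIV. scale (of_int (c i) - of_int (from_list zs i)) (basis_family h e i)) = 0"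
    by (simp add: lincomb_def scale_left_diff_distrib sum_subtractf)
  from basis_independent_coeffs[OF this] show "c = from_list zs"
    by auto
qed

lemma basis_family_lincomb: "j < 14 \<Longrightarrow> basis_family h e (basis_list ! j) = lincomb (unit_list j)"
  by (simp add: lincomb_nth unit_list_def nth_list_update if_distrib if_distribR cong: if_cong)

text \<open>Complex division by a factorial becomes exact integer division of coordinates; this is
  how the divided powers are seen to preserve the integral lattice.\<close>

lemma scale_lincomb:
  assumes "length zs = 14" "\<forall>z\<in>set zs. d dvd z" "d \<noteq> 0"
  shows "scale (1 / of_int d) (lincomb zs) = lincomb (map (\<lambda>z. z div d) zs)"
proof -
  have "of_int (zs ! k) / of_int d = (of_int (zs ! k div d) :: complex)" if "k < 14" for k
    using assms that by (metis nth_mem of_int_divide_in_Ints of_int_div)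
  then show ?thesis
    using assms by (simp add: lincomb_nth scale_sum_right)
qed

text \<open>\<open>base_change\<close> sees a map only through the images of basis vectors, so the
  facts on D needed for divisibility by 2! and 3! and for nilpotency are finite checks on unit
  lists. The four summands of each entry are the terms k = 0, 1, 2, 3 of the exponential.\<close>

lemma root_element_from_list:
  fixes D :: "int list \<Rightarrow> int list" and vs :: "'k::comm_ring_1 list"
  assumes D: "\<And>zs. length zs = 14 \<Longrightarrow> bracket (e r) (lincomb zs) = lincomb (D zs)"
    and len [simp]: "\<And>zs. length zs = 14 \<Longrightarrow> length (D zs) = 14"
    and dvd2: "\<forall>j\<in>{..<14}. \<forall>z\<in>set (D (D (unit_list j))). 2 dvd z"
    and dvd6: "\<forall>j\<in>{..<14}. \<forall>z\<in>set (D (D (D (unit_list j)))). 6 dvd z"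
    and nil: "\<forall>j\<in>{..<14}. \<forall>z\<in>set (D (D (D (D (unit_list j))))). z = 0"
    and vs: "length vs = 14"
  shows "root_element r t (from_list vs) = from_list (map (\<lambda>i. vs ! i
     + t * (\<Sum>j<14. of_int (D (unit_list j) ! i) * vs ! j)
     + t^2 * (\<Sum>j<14. of_int (D (D (unit_list j)) ! i div 2) * vs ! j)
     + t^3 * (\<Sum>j<14. of_int (D (D (D (unit_list j))) ! i div 6) * vs ! j))
     [0, 1, 2, 3, 4, 5, 6, 7, 8, 9, 10, 11, 12, 13])"
proof
  fix i
  obtain l where l: "l < 14" and i: "i = basis_list ! l"
    by (rule basis_cases)
  \<comment> \<open>The statement uses a literal index list so that it can be evaluated later; here
    l is a variable, and the entry at l is found by passing through \<open>[0..<14]\<close>.\<close>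
  have "[0..<14] = [0, 1, 2, 3, 4, 5, 6, 7, 8, 9, 10, 11, 12, 13]"
    by (simp add: upt_conv_Cons)
  from this[symmetric] l
  have upt: "map f [0, 1, 2, 3, 4, 5, 6, 7, 8, 9, 10, 11, 12, 13] ! l = f l"
    for f :: "nat \<Rightarrow> 'k"
    by (simp del: upt_rec_numeral)
  have [simp]: "length (unit_list j) = 14" for j
    by (simp add: unit_list_def)
  \<comment> \<open>\<open>c k j\<close> is the entry in row l and column j of the k-th divided
    power of \<open>ad e_r\<close>.\<close>
  define c where "c k j = int_coords (ad_divided_power r k (basis_family h e (basis_list ! j)))
     (basis_list ! l)" for k j
  have bc: "base_change (ad_divided_power r k) (from_list vs) i = (\<Sum>j<14. of_int (c k j) * vs ! j)" for k
    using vs by (simp add: base_change_def sum_UNIV_basis c_def i)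
  have nil: "D (D (D (D (unit_list j)))) = replicate 14 0" if "j < 14" for j
    using nil that by (intro replicate_eqI) simp_all
  have ad: "bracket (e r) (basis_family h e (basis_list ! j)) = lincomb (D (unit_list j))"
    "bracket (e r) (bracket (e r) (basis_family h e (basis_list ! j))) = lincomb (D (D (unit_list j)))"
    "bracket (e r) (bracket (e r) (bracket (e r) (basis_family h e (basis_list ! j)))) =
      lincomb (D (D (D (unit_list j))))"
    "bracket (e r) (bracket (e r) (bracket (e r) (bracket (e r) (basis_family h e (basis_list ! j))))) = 0"
    if "j < 14" for j
    using that by (simp_all add: basis_family_lincomb D nil) (simp add: lincomb_nth)
  have c0: "c 0 j = (if j = l then 1 else 0)" if "j < 14" for j
    using that l by (simp add: c_def ad_divided_power_def basis_family_lincomb int_coords_lincomb)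
      (auto simp: unit_list_def nth_list_update)
  have c1: "c 1 j = D (unit_list j) ! l" if "j < 14" for j
    using that l by (simp add: c_def ad_divided_power_def ad int_coords_lincomb)
  have c2: "c 2 j = D (D (unit_list j)) ! l div 2" if "j < 14" for j
    using that l scale_lincomb[of "D (D (unit_list j))" 2] dvd2
    by (simp add: c_def ad_divided_power_def ad D int_coords_lincomb numeral_2_eq_2)
  have c3: "c 3 j = D (D (D (unit_list j))) ! l div 6" if "j < 14" for j
    using that l scale_lincomb[of "D (D (D (unit_list j)))" 6] dvd6
    by (simp add: c_def ad_divided_power_def ad D int_coords_lincomb numeral_3_eq_3 fact_numeral)
  have c4: "c k j = 0" if "k \<ge> 4" "j < 14" for k j
  proof -
    have "(bracket (e r) ^^ 4) (basis_family h e (basis_list ! j)) = 0"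
      using ad(4)[OF that(2)] by (simp add: numeral_eq_Suc)
    moreover have "(bracket (e r) ^^ m) 0 = 0" for m
      by (induction m) (simp_all add: bracket_0_right)
    moreover have "bracket (e r) ^^ k = (bracket (e r) ^^ (k - 4)) \<circ> (bracket (e r) ^^ 4)"
      using that(1) by (simp flip: funpow_add)
    \<comment> \<open>Zero is presented as the \<open>lincomb\<close> of a zero list so that
      \<open>int_coords_lincomb\<close> can read off its coordinates.\<close>
    ultimately have "ad_divided_power r k (basis_family h e (basis_list ! j)) = lincomb (replicate 14 0)"
      by (simp add: ad_divided_power_def lincomb_nth)
    then show ?thesis
      using l by (simp add: c_def int_coords_lincomb)
  qed
  have "root_element r t (from_list vs) i =
     Sum_any (\<lambda>k. t ^ k * (\<Sum>j<14. of_int (c k j) * vs ! j))"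
    unfolding root_element_def bc ..
  also have "\<dots> = (\<Sum>k<4. t ^ k * (\<Sum>j<14. of_int (c k j) * vs ! j))"
  proof (rule Sum_any.expand_superset)
    have "t ^ k * (\<Sum>j<14. of_int (c k j) * vs ! j) = 0" if "\<not> k < 4" for k
      using that c4 by simp
    then show "{k. t ^ k * (\<Sum>j<14. of_int (c k j) * vs ! j) \<noteq> 0} \<subseteq> {..<4}"
      by auto
  qed simp
  also have "\<dots> = vs ! l + t * (\<Sum>j<14. of_int (c 1 j) * vs ! j)
     + t^2 * (\<Sum>j<14. of_int (c 2 j) * vs ! j) + t^3 * (\<Sum>j<14. of_int (c 3 j) * vs ! j)"
  proof -
    have "(\<Sum>j<14. of_int (c 0 j) * vs ! j) = (\<Sum>j<14. if j = l then vs ! j else 0)"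
      by (intro sum.cong) (simp_all add: c0)
    then have "(\<Sum>j<14. of_int (c 0 j) * vs ! j) = vs ! l"
      using l by simp
    moreover have "(\<Sum>k<4. f k) = f 0 + f 1 + f 2 + f 3" for f :: "nat \<Rightarrow> 'k"
      by (simp add: lessThan_nat_numeral lessThan_Suc ac_simps)
    ultimately show ?thesis
      by simp
  qed
  finally show "root_element r t (from_list vs) i = from_list (map (\<lambda>i. vs ! i
     + t * (\<Sum>j<14. of_int (D (unit_list j) ! i) * vs ! j)
     + t^2 * (\<Sum>j<14. of_int (D (D (unit_list j)) ! i div 2) * vs ! j)
     + t^3 * (\<Sum>j<14. of_int (D (D (D (unit_list j))) ! i div 6) * vs ! j))
     [0, 1, 2, 3, 4, 5, 6, 7, 8, 9, 10, 11, 12, 13]) i"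
    using l by (simp only: i from_list_nth length_map list.size upt) (simp add: c1 c2 c3 del: One_nat_def)
qed

end

section \<open>The twelve adjoint maps as integer tables\<close>

text \<open>\<open>ad_i_j\<close> is \<open>ad e\<^sub>r\<close> in coordinates, for \<open>r = i a + j b\<close>; a letter \<open>m\<close> stands for a minus sign.\<close>

definition ad_1_0 :: "int list \<Rightarrow> int list" where
  "ad_1_0 zs =
    [zs ! 8, 0, - (2 * zs ! 0) + zs ! 1, 0, zs ! 3, 2 * zs ! 4, 3 * zs ! 5, 0, 0, - (3 * zs ! 10),
     - (2 * zs ! 11), - zs ! 12, 0, 0]"

definition ad_0_1 :: "int list \<Rightarrow> int list" where
  "ad_0_1 zs =
    [0, zs ! 9, 0, 3 * zs ! 0 - 2 * zs ! 1, - zs ! 2, 0, 0, zs ! 6, zs ! 10, 0, 0, 0, - zs ! 13, 0]"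

definition ad_1_1 :: "int list \<Rightarrow> int list" where
  "ad_1_1 zs =
    [zs ! 10, 3 * zs ! 10, zs ! 9, - (3 * zs ! 8), zs ! 0 - zs ! 1, - (2 * zs ! 2), 0,
     - (3 * zs ! 5), 2 * zs ! 11, 0, 0, zs ! 13, 0, 0]"

definition ad_2_1 :: "int list \<Rightarrow> int list" where
  "ad_2_1 zs =
    [2 * zs ! 11, 3 * zs ! 11, 2 * zs ! 10, 0, - (2 * zs ! 8), - zs ! 0, - (3 * zs ! 2), 3 * zs ! 4,
     zs ! 12, 0, - zs ! 13, 0, 0, 0]"

definition ad_3_1 :: "int list \<Rightarrow> int list" where
  "ad_3_1 zs =
    [zs ! 12, zs ! 12, zs ! 11, 0, 0, - zs ! 8, - (3 * zs ! 0) + zs ! 1, - zs ! 3, 0, zs ! 13, 0, 0,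
     0, 0]"

definition ad_3_2 :: "int list \<Rightarrow> int list" where
  "ad_3_2 zs =
    [zs ! 13, 2 * zs ! 13, 0, zs ! 12, - zs ! 11, zs ! 10, - zs ! 9, - zs ! 1, 0, 0, 0, 0, 0, 0]"

definition ad_m1_0 :: "int list \<Rightarrow> int list" where
  "ad_m1_0 zs =
    [- zs ! 2, 0, 0, 3 * zs ! 4, 2 * zs ! 5, zs ! 6, 0, 0, 2 * zs ! 0 - zs ! 1, 0, - zs ! 9,
     - (2 * zs ! 10), - (3 * zs ! 11), 0]"

definition ad_0_m1 :: "int list \<Rightarrow> int list" where
  "ad_0_m1 zs =
    [0, - zs ! 3, - zs ! 4, 0, 0, 0, zs ! 7, 0, 0, - (3 * zs ! 0) + 2 * zs ! 1, zs ! 8, 0, 0,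
     - zs ! 12]"

definition ad_m1_m1 :: "int list \<Rightarrow> int list" where
  "ad_m1_m1 zs =
    [- zs ! 4, - (3 * zs ! 4), - (2 * zs ! 5), 0, 0, - zs ! 7, 0, 0, - zs ! 3, 3 * zs ! 2,
     - zs ! 0 + zs ! 1, 2 * zs ! 8, 0, 3 * zs ! 11]"

definition ad_m2_m1 :: "int list \<Rightarrow> int list" where
  "ad_m2_m1 zs =
    [- (2 * zs ! 5), - (3 * zs ! 5), - zs ! 6, 0, zs ! 7, 0, 0, 0, - (2 * zs ! 4), 0, 2 * zs ! 2,
     zs ! 0, 3 * zs ! 8, - (3 * zs ! 10)]"

definition ad_m3_m1 :: "int list \<Rightarrow> int list" where
  "ad_m3_m1 zs =
    [- zs ! 6, - zs ! 6, 0, - zs ! 7, 0, 0, 0, 0, - zs ! 5, 0, 0, zs ! 2, 3 * zs ! 0 - zs ! 1,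
     zs ! 9]"

definition ad_m3_m2 :: "int list \<Rightarrow> int list" where
  "ad_m3_m2 zs =
    [- zs ! 7, - (2 * zs ! 7), 0, 0, 0, 0, 0, 0, 0, - zs ! 6, zs ! 5, - zs ! 4, zs ! 3, zs ! 1]"

lemmas ad_list_defs =
  ad_1_0_def ad_0_1_def ad_1_1_def ad_2_1_def ad_3_1_def ad_3_2_def
  ad_m1_0_def ad_0_m1_def ad_m1_m1_def ad_m2_m1_def ad_m3_m1_def ad_m3_m2_def

text \<open>Restricting the argument to a nonempty list stops the simplifier from unfolding the maps
  before their argument is known.\<close>

lemmas ad_list_Cons = ad_list_defs[of "z # zs" for z zs]

context G2_chevalley_basis
begin

lemma bracket_e_h:
  assumes "rt m n \<in> G2_roots" "rt m' n' \<in> G2_roots"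
  shows "bracket (e (rt m n)) (h (rt m' n')) =
    scale (- of_real (cartan_number (rt m' n') (rt m n))) (e (rt m n))"
  using bracket_h_e[OF assms(2,1)]
  by (subst bracket_antisym) (simp del: rt_in_G2_roots)

text \<open>This rule and the next two share a left-hand side. Their arithmetic side conditions
  exclude one another, so on numerals the simplifier selects the right case of the multiplication
  table.\<close>

lemma bracket_e_e_neg:
  assumes "rt m n \<in> G2_roots" "rt m' n' \<in> G2_roots" "m + m' = 0" "n + n' = 0"
  shows "bracket (e (rt m n)) (e (rt m' n')) =
    scale (of_int (coroot_a m n)) (h (rt 1 0)) + scale (of_int (coroot_b m n)) (h (rt 0 1))"
proof -
  have "rt m' n' = - rt m n"
    using assms(3,4) by (simp add: eq_neg_iff_add_eq_0 add.commute)
  then show ?thesis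
    using assms(1) bracket_e_neg[OF assms(1)] h_rt[OF assms(1)] by (simp only: flip: alpha_rt beta_rt)
qed

lemma bracket_e_e_root:
  assumes "rt m n \<in> G2_roots" "rt m' n' \<in> G2_roots" "rt (m + m') (n + n') \<in> G2_roots"
  shows "bracket (e (rt m n)) (e (rt m' n')) =
    scale (of_int (N (rt m n) (rt m' n'))) (e (rt (m + m') (n + n')))"
  using bracket_e_e[of "rt m n" "rt m' n'"] assms by (simp del: rt_in_G2_roots)

lemma bracket_e_e_nonroot:
  assumes "rt m n \<in> G2_roots" "rt m' n' \<in> G2_roots" "rt (m + m') (n + n') \<notin> G2_roots"
    "\<not> (m + m' = 0 \<and> n + n' = 0)"
  shows "bracket (e (rt m n)) (e (rt m' n')) = 0"
  using bracket_e_e_0[of "rt m n" "rt m' n'"] assms by (simp del: rt_in_G2_roots)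

end

section \<open>The twelve root elements as matrices\<close>

context G2_positive_basis
begin

lemmas bracket_e_lincomb_simps = lincomb_Cons bracket_add_right bracket_scale_right
  bracket_e_h bracket_e_e_neg bracket_e_e_root bracket_e_e_nonroot N_values
  cartan_number_rt coroot_a_def coroot_b_def scale_left_distrib scale_right_distrib
  scale_left_diff_distrib scale_right_diff_distrib ac_simps ad_list_defs

text \<open>This certifies the tables. For a root r, the two leading entries are the coroot
  coefficients of r times the coordinate at -r, the entry at r carries the negated Cartan numbers,
  and any other root s receives N_{r,s-r} times the coordinate at s-r when s-r is a root.\<close>

lemma bracket_e_lincomb:
  assumes "length zs = 14"
  shows
    "bracket (e (rt 1 0)) (lincomb zs) = lincomb (ad_1_0 zs)"
    "bracket (e (rt 0 1)) (lincomb zs) = lincomb (ad_0_1 zs)"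
    "bracket (e (rt 1 1)) (lincomb zs) = lincomb (ad_1_1 zs)"
    "bracket (e (rt 2 1)) (lincomb zs) = lincomb (ad_2_1 zs)"
    "bracket (e (rt 3 1)) (lincomb zs) = lincomb (ad_3_1 zs)"
    "bracket (e (rt 3 2)) (lincomb zs) = lincomb (ad_3_2 zs)"
    "bracket (e (rt (-1) 0)) (lincomb zs) = lincomb (ad_m1_0 zs)"
    "bracket (e (rt 0 (-1))) (lincomb zs) = lincomb (ad_0_m1 zs)"
    "bracket (e (rt (-1) (-1))) (lincomb zs) = lincomb (ad_m1_m1 zs)"
    "bracket (e (rt (-2) (-1))) (lincomb zs) = lincomb (ad_m2_m1 zs)"
    "bracket (e (rt (-3) (-1))) (lincomb zs) = lincomb (ad_m3_m1 zs)"
    "bracket (e (rt (-3) (-2))) (lincomb zs) = lincomb (ad_m3_m2 zs)"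
  by (rule length_14E[OF assms]; simp add: bracket_e_lincomb_simps)+

lemmas root_element_simps = unit_list_simps ad_list_Cons lessThan_nat_numeral lessThan_Suc

lemma length_ad_list:
  "length (ad_1_0 zs) = 14"
  "length (ad_0_1 zs) = 14"
  "length (ad_1_1 zs) = 14"
  "length (ad_2_1 zs) = 14"
  "length (ad_3_1 zs) = 14"
  "length (ad_3_2 zs) = 14"
  "length (ad_m1_0 zs) = 14"
  "length (ad_0_m1 zs) = 14"
  "length (ad_m1_m1 zs) = 14"
  "length (ad_m2_m1 zs) = 14"
  "length (ad_m3_m1 zs) = 14"
  "length (ad_m3_m2 zs) = 14"
  by (simp_all add: ad_list_defs)

text \<open>Coefficients such as 1, 3, 3, 1 come from the a-string from b to 3a+b, after division by
  k!. The term with \<open>- t^2 * v8\<close> comes from the chain from the root vector of -a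
  through its coroot element to -2 times the root vector of a. Cubic terms occur exactly for short
  roots, the only ones with strings of four roots.\<close>

lemma root_element_1_0:
  "root_element (rt 1 0) t (from_list
      [v0, v1, v2, v3, v4, v5, v6, v7, v8, v9, v10, v11, v12, v13]) = from_list
    [v0 + t * v8, v1, v2 - 2 * t * v0 + t * v1 - t^2 * v8, v3, v4 + t * v3,
     v5 + 2 * t * v4 + t^2 * v3, v6 + 3 * t * v5 + 3 * t^2 * v4 + t^3 * v3, v7, v8,
     v9 - 3 * t * v10 + 3 * t^2 * v11 - t^3 * v12, v10 - 2 * t * v11 + t^2 * v12, v11 - t * v12, v12,
     v13]"
  by (subst root_element_from_list[OF bracket_e_lincomb(1)])
    (simp_all add: root_element_simps length_ad_list algebra_simps)

lemma root_element_0_1: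
  "root_element (rt 0 1) t (from_list
      [v0, v1, v2, v3, v4, v5, v6, v7, v8, v9, v10, v11, v12, v13]) = from_list
    [v0, v1 + t * v9, v2, v3 + 3 * t * v0 - 2 * t * v1 - t^2 * v9, v4 - t * v2, v5, v6, v7 + t * v6,
     v8 + t * v10, v9, v10, v11, v12 - t * v13, v13]"
  by (subst root_element_from_list[OF bracket_e_lincomb(2)])
    (simp_all add: root_element_simps length_ad_list algebra_simps)

lemma root_element_1_1:
  "root_element (rt 1 1) t (from_list
      [v0, v1, v2, v3, v4, v5, v6, v7, v8, v9, v10, v11, v12, v13]) = from_list
    [v0 + t * v10, v1 + 3 * t * v10, v2 + t * v9, v3 - 3 * t * v8 - 3 * t^2 * v11 - t^3 * v13,
     v4 + t * v0 - t * v1 - t^2 * v10, v5 - 2 * t * v2 - t^2 * v9, v6,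
     v7 - 3 * t * v5 + 3 * t^2 * v2 + t^3 * v9, v8 + 2 * t * v11 + t^2 * v13, v9, v10, v11 + t * v13,
     v12, v13]"
  by (subst root_element_from_list[OF bracket_e_lincomb(3)])
    (simp_all add: root_element_simps length_ad_list algebra_simps)

lemma root_element_2_1:
  "root_element (rt 2 1) t (from_list
      [v0, v1, v2, v3, v4, v5, v6, v7, v8, v9, v10, v11, v12, v13]) = from_list
    [v0 + 2 * t * v11, v1 + 3 * t * v11, v2 + 2 * t * v10 - t^2 * v13, v3,
     v4 - 2 * t * v8 - t^2 * v12, v5 - t * v0 - t^2 * v11,
     v6 - 3 * t * v2 - 3 * t^2 * v10 + t^3 * v13, v7 + 3 * t * v4 - 3 * t^2 * v8 - t^3 * v12,
     v8 + t * v12, v9, v10 - t * v13, v11, v12, v13]"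
  by (subst root_element_from_list[OF bracket_e_lincomb(4)])
    (simp_all add: root_element_simps length_ad_list algebra_simps)

lemma root_element_3_1:
  "root_element (rt 3 1) t (from_list
      [v0, v1, v2, v3, v4, v5, v6, v7, v8, v9, v10, v11, v12, v13]) = from_list
    [v0 + t * v12, v1 + t * v12, v2 + t * v11, v3, v4, v5 - t * v8,
     v6 - 3 * t * v0 + t * v1 - t^2 * v12, v7 - t * v3, v8, v9 + t * v13, v10, v11, v12, v13]"
  by (subst root_element_from_list[OF bracket_e_lincomb(5)])
    (simp_all add: root_element_simps length_ad_list algebra_simps)

lemma root_element_3_2:
  "root_element (rt 3 2) t (from_list
      [v0, v1, v2, v3, v4, v5, v6, v7, v8, v9, v10, v11, v12, v13]) = from_list
    [v0 + t * v13, v1 + 2 * t * v13, v2, v3 + t * v12, v4 - t * v11, v5 + t * v10, v6 - t * v9,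
     v7 - t * v1 - t^2 * v13, v8, v9, v10, v11, v12, v13]"
  by (subst root_element_from_list[OF bracket_e_lincomb(6)])
    (simp_all add: root_element_simps length_ad_list algebra_simps)

lemma root_element_m1_0:
  "root_element (rt (-1) 0) t (from_list
      [v0, v1, v2, v3, v4, v5, v6, v7, v8, v9, v10, v11, v12, v13]) = from_list
    [v0 - t * v2, v1, v2, v3 + 3 * t * v4 + 3 * t^2 * v5 + t^3 * v6, v4 + 2 * t * v5 + t^2 * v6,
     v5 + t * v6, v6, v7, v8 + 2 * t * v0 - t * v1 - t^2 * v2, v9, v10 - t * v9,
     v11 - 2 * t * v10 + t^2 * v9, v12 - 3 * t * v11 + 3 * t^2 * v10 - t^3 * v9, v13]"
  by (subst root_element_from_list[OF bracket_e_lincomb(7)])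
    (simp_all add: root_element_simps length_ad_list algebra_simps)

lemma root_element_0_m1:
  "root_element (rt 0 (-1)) t (from_list
      [v0, v1, v2, v3, v4, v5, v6, v7, v8, v9, v10, v11, v12, v13]) = from_list
    [v0, v1 - t * v3, v2 - t * v4, v3, v4, v5, v6 + t * v7, v7, v8,
     v9 - 3 * t * v0 + 2 * t * v1 - t^2 * v3, v10 + t * v8, v11, v12, v13 - t * v12]"
  by (subst root_element_from_list[OF bracket_e_lincomb(8)])
    (simp_all add: root_element_simps length_ad_list algebra_simps)

lemma root_element_m1_m1:
  "root_element (rt (-1) (-1)) t (from_list
      [v0, v1, v2, v3, v4, v5, v6, v7, v8, v9, v10, v11, v12, v13]) = from_list
    [v0 - t * v4, v1 - 3 * t * v4, v2 - 2 * t * v5 + t^2 * v7, v3, v4, v5 - t * v7, v6, v7,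
     v8 - t * v3, v9 + 3 * t * v2 - 3 * t^2 * v5 + t^3 * v7, v10 - t * v0 + t * v1 - t^2 * v4,
     v11 + 2 * t * v8 - t^2 * v3, v12, v13 + 3 * t * v11 + 3 * t^2 * v8 - t^3 * v3]"
  by (subst root_element_from_list[OF bracket_e_lincomb(9)])
    (simp_all add: root_element_simps length_ad_list algebra_simps)

lemma root_element_m2_m1:
  "root_element (rt (-2) (-1)) t (from_list
      [v0, v1, v2, v3, v4, v5, v6, v7, v8, v9, v10, v11, v12, v13]) = from_list
    [v0 - 2 * t * v5, v1 - 3 * t * v5, v2 - t * v6, v3, v4 + t * v7, v5, v6, v7,
     v8 - 2 * t * v4 - t^2 * v7, v9, v10 + 2 * t * v2 - t^2 * v6, v11 + t * v0 - t^2 * v5,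
     v12 + 3 * t * v8 - 3 * t^2 * v4 - t^3 * v7, v13 - 3 * t * v10 - 3 * t^2 * v2 + t^3 * v6]"
  by (subst root_element_from_list[OF bracket_e_lincomb(10)])
    (simp_all add: root_element_simps length_ad_list algebra_simps)

lemma root_element_m3_m1:
  "root_element (rt (-3) (-1)) t (from_list
      [v0, v1, v2, v3, v4, v5, v6, v7, v8, v9, v10, v11, v12, v13]) = from_list
    [v0 - t * v6, v1 - t * v6, v2, v3 - t * v7, v4, v5, v6, v7, v8 - t * v5, v9, v10, v11 + t * v2,
     v12 + 3 * t * v0 - t * v1 - t^2 * v6, v13 + t * v9]"
  by (subst root_element_from_list[OF bracket_e_lincomb(11)])
    (simp_all add: root_element_simps length_ad_list algebra_simps)

lemma root_element_m3_m2:
  "root_element (rt (-3) (-2)) t (from_list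
      [v0, v1, v2, v3, v4, v5, v6, v7, v8, v9, v10, v11, v12, v13]) = from_list
    [v0 - t * v7, v1 - 2 * t * v7, v2, v3, v4, v5, v6, v7, v8, v9 - t * v6, v10 + t * v5,
     v11 - t * v4, v12 + t * v3, v13 + t * v1 - t^2 * v7]"
  by (subst root_element_from_list[OF bracket_e_lincomb(12)])
    (simp_all add: root_element_simps length_ad_list algebra_simps)

lemmas root_element_rt =
  root_element_1_0 root_element_0_1 root_element_1_1 root_element_2_1 root_element_3_1 root_element_3_2
  root_element_m1_0 root_element_0_m1 root_element_m1_m1 root_element_m2_m1 root_element_m3_m1 root_element_m3_m2

text \<open>\<open>inv\<close> in \<open>commutator\<close> is a choice operator and has to be tied
  to a genuine inverse. The inverse of x_r(t) is x_r(-t); using the coordinate identity for t and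
  for -t gives both compositions.\<close>

lemma bij_root_element:
  fixes t :: "'k::comm_ring_1"
  assumes "rt m n \<in> G2_roots"
  shows "bij (root_element (rt m n) t)"
proof -
  have inv: "root_element (rt m n) u (root_element (rt m n) (- u) v) = v" for u :: 'k and v
  proof -
    obtain v0 v1 v2 v3 v4 v5 v6 v7 v8 v9 v10 v11 v12 v13 where
      v: "v = from_list [v0, v1, v2, v3, v4, v5, v6, v7, v8, v9, v10, v11, v12, v13]"
      by (rule from_list_cases)
    show ?thesis
      using assms unfolding rt_in_G2_roots v
      by (elim insertE emptyE)
        (simp_all add: root_element_rt algebra_simps power2_eq_square power3_eq_cube)
  qed
  show ?thesis
    using inv[of t] inv[of "- t"]
    by (intro o_bij[of "root_element (rt m n) (- t)"]) (simp_all add: fun_eq_iff)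
qed

text \<open>The premise contains no \<open>inv\<close> and speaks only of literal vectors, which are
  the ones that \<open>root_element_rt\<close> can rewrite. The two inverses are then cancelled by
  injectivity.\<close>

lemma commutator_eqI:
  fixes t u :: "'k::comm_ring_1"
  assumes "rt m n \<in> G2_roots" "rt m' n' \<in> G2_roots"
    and "\<And>v0 v1 v2 v3 v4 v5 v6 v7 v8 v9 v10 v11 v12 v13.
      let v = from_list [v0, v1, v2, v3, v4, v5, v6, v7, v8, v9, v10, v11, v12, v13]
      in root_element (rt m n) u (root_element (rt m' n') t v) =
        root_element (rt m' n') t (root_element (rt m n) u (f v))"
  shows "commutator (root_element (rt m n) u) (root_element (rt m' n') t) = f"
proof
  fix v :: "'k L_over"
  obtain v0 v1 v2 v3 v4 v5 v6 v7 v8 v9 v10 v11 v12 v13 where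
    "v = from_list [v0, v1, v2, v3, v4, v5, v6, v7, v8, v9, v10, v11, v12, v13]"
    by (rule from_list_cases)
  then have "root_element (rt m n) u (root_element (rt m' n') t v) =
      root_element (rt m' n') t (root_element (rt m n) u (f v))"
    using assms(3) by (simp add: Let_def)
  then show "commutator (root_element (rt m n) u) (root_element (rt m' n') t) v = f v"
    using bij_root_element[OF assms(1), of u] bij_root_element[OF assms(2), of t]
    by (simp add: commutator_def bij_is_inj)
qed

end

section \<open>The commutator formulas\<close>

lemma root_conversions:
  "\<alpha> + \<beta> = rt 1 1" "2 *\<^sub>R \<alpha> + \<beta> = rt 2 1" "3 *\<^sub>R \<alpha> + \<beta> = rt 3 1"
  "3 *\<^sub>R \<alpha> + 2 *\<^sub>R \<beta> = rt 3 2"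
  "- \<alpha> - \<beta> = rt (- 1) (- 1)" "- 2 *\<^sub>R \<alpha> - \<beta> = rt (- 2) (- 1)"
  "- 3 *\<^sub>R \<alpha> - \<beta> = rt (- 3) (- 1)" "- 3 *\<^sub>R \<alpha> - 2 *\<^sub>R \<beta> = rt (- 3) (- 2)"
  "- \<alpha> = rt (- 1) 0" "- \<beta> = rt 0 (- 1)"
  by (simp_all add: rt_def)

theorem mainTheorem4:
  fixes scale :: "complex \<Rightarrow> 'l::ab_group_add \<Rightarrow> 'l"
    and bracket :: "'l \<Rightarrow> 'l \<Rightarrow> 'l"
    and h e :: "real^3 \<Rightarrow> 'l"
    and N :: "real^3 \<Rightarrow> real^3 \<Rightarrow> int"
    and x :: "real^3 \<Rightarrow> 'k::comm_ring_1 \<Rightarrow> 'k L_over \<Rightarrow> 'k L_over"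
  assumes "G2_chevalley_basis scale bracket h e N"
    and "N \<alpha> \<beta> > 0"
    and "N \<alpha> (\<alpha> + \<beta>) > 0"
    and "N \<alpha> (2 *\<^sub>R \<alpha> + \<beta>) > 0"
    and "N \<beta> (3 *\<^sub>R \<alpha> + \<beta>) > 0"
    and "x = G2_chevalley_basis.root_element scale bracket h e"
  shows "\<forall>t u.
      commutator (x \<beta> u) (x \<alpha> t) =
        x (\<alpha> + \<beta>) (- (t * u)) \<circ> x (2 *\<^sub>R \<alpha> + \<beta>) (t^2 * u) \<circ> x (3 *\<^sub>R \<alpha> + \<beta>) (- (t^3 * u)) \<circ> x (3 *\<^sub>R \<alpha> + 2 *\<^sub>R \<beta>) (- (t^3 * u^2)) \<and>
      commutator (x \<alpha> u) (x \<beta> t) =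
        x (\<alpha> + \<beta>) (t * u) \<circ> x (2 *\<^sub>R \<alpha> + \<beta>) (- (t * u^2)) \<circ> x (3 *\<^sub>R \<alpha> + \<beta>) (t * u^3) \<circ> x (3 *\<^sub>R \<alpha> + 2 *\<^sub>R \<beta>) (- (2 * t^2 * u^3)) \<and>
      commutator (x (\<alpha> + \<beta>) u) (x \<alpha> t) =
        x (2 *\<^sub>R \<alpha> + \<beta>) (- (2 * t * u)) \<circ> x (3 *\<^sub>R \<alpha> + \<beta>) (3 * t^2 * u) \<circ> x (3 *\<^sub>R \<alpha> + 2 *\<^sub>R \<beta>) (- (3 * t * u^2)) \<and>
      commutator (x (2 *\<^sub>R \<alpha> + \<beta>) u) (x \<alpha> t) =
        x (3 *\<^sub>R \<alpha> + \<beta>) (- (3 * t * u)) \<and>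
      commutator (x (3 *\<^sub>R \<alpha> + \<beta>) u) (x \<beta> t) =
        x (3 *\<^sub>R \<alpha> + 2 *\<^sub>R \<beta>) (- (t * u)) \<and>
      commutator (x (2 *\<^sub>R \<alpha> + \<beta>) u) (x (\<alpha> + \<beta>) t) =
        x (3 *\<^sub>R \<alpha> + 2 *\<^sub>R \<beta>) (3 * t * u) \<and>
      commutator (x (- \<beta>) u) (x (- \<alpha>) t) =
        x (- \<alpha> - \<beta>) (t * u) \<circ> x (- 2 *\<^sub>R \<alpha> - \<beta>) (t^2 * u) \<circ> x (- 3 *\<^sub>R \<alpha> - \<beta>) (t^3 * u) \<circ> x (- 3 *\<^sub>R \<alpha> - 2 *\<^sub>R \<beta>) (- (t^3 * u^2)) \<and>
      commutator (x (- \<alpha>) u) (x (- \<beta>) t) =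
        x (- \<alpha> - \<beta>) (- (t * u)) \<circ> x (- 2 *\<^sub>R \<alpha> - \<beta>) (- (t * u^2)) \<circ> x (- 3 *\<^sub>R \<alpha> - \<beta>) (- (t * u^3)) \<circ> x (- 3 *\<^sub>R \<alpha> - 2 *\<^sub>R \<beta>) (- (2 * t^2 * u^3)) \<and>
      commutator (x (- \<alpha> - \<beta>) u) (x (- \<alpha>) t) =
        x (- 2 *\<^sub>R \<alpha> - \<beta>) (2 * t * u) \<circ> x (- 3 *\<^sub>R \<alpha> - \<beta>) (3 * t^2 * u) \<circ> x (- 3 *\<^sub>R \<alpha> - 2 *\<^sub>R \<beta>) (- (3 * t * u^2)) \<and>
      commutator (x (- 2 *\<^sub>R \<alpha> - \<beta>) u) (x (- \<alpha>) t) =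
        x (- 3 *\<^sub>R \<alpha> - \<beta>) (3 * t * u) \<and>
      commutator (x (- 3 *\<^sub>R \<alpha> - \<beta>) u) (x (- \<beta>) t) =
        x (- 3 *\<^sub>R \<alpha> - 2 *\<^sub>R \<beta>) (t * u) \<and>
      commutator (x (- 2 *\<^sub>R \<alpha> - \<beta>) u) (x (- \<alpha> - \<beta>) t) =
        x (- 3 *\<^sub>R \<alpha> - 2 *\<^sub>R \<beta>) (- (3 * t * u)) \<and>
      commutator (x (- \<alpha> - \<beta>) u) (x \<alpha> t) =
        x (- \<beta>) (3 * t * u) \<and>
      commutator (x (- 2 *\<^sub>R \<alpha> - \<beta>) u) (x \<alpha> t) =
        x (- \<alpha> - \<beta>) (2 * t * u) \<circ> x (- \<beta>) (3 * t^2 * u) \<circ> x (- 3 *\<^sub>R \<alpha> - 2 *\<^sub>R \<beta>) (3 * t * u^2) \<and>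
      commutator (x (- 3 *\<^sub>R \<alpha> - \<beta>) u) (x \<alpha> t) =
        x (- 2 *\<^sub>R \<alpha> - \<beta>) (t * u) \<circ> x (- \<alpha> - \<beta>) (t^2 * u) \<circ> x (- \<beta>) (t^3 * u) \<circ> x (- 3 *\<^sub>R \<alpha> - 2 *\<^sub>R \<beta>) (t^3 * u^2) \<and>
      commutator (x \<alpha> u) (x (- 3 *\<^sub>R \<alpha> - \<beta>) t) =
        x (- 2 *\<^sub>R \<alpha> - \<beta>) (- (t * u)) \<circ> x (- \<alpha> - \<beta>) (- (t * u^2)) \<circ> x (- \<beta>) (- (t * u^3)) \<circ> x (- 3 *\<^sub>R \<alpha> - 2 *\<^sub>R \<beta>) (2 * t^2 * u^3) \<and>
      commutator (x \<beta> u) (x (- \<alpha> - \<beta>) t) =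
        x (- \<alpha>) (t * u) \<circ> x (- 2 *\<^sub>R \<alpha> - \<beta>) (- (t^2 * u)) \<circ> x (- 3 *\<^sub>R \<alpha> - 2 *\<^sub>R \<beta>) (t^3 * u) \<circ> x (- 3 *\<^sub>R \<alpha> - \<beta>) (- (t^3 * u^2)) \<and>
      commutator (x (- \<alpha> - \<beta>) u) (x \<beta> t) =
        x (- \<alpha>) (- (t * u)) \<circ> x (- 2 *\<^sub>R \<alpha> - \<beta>) (t * u^2) \<circ> x (- 3 *\<^sub>R \<alpha> - 2 *\<^sub>R \<beta>) (- (t * u^3)) \<circ> x (- 3 *\<^sub>R \<alpha> - \<beta>) (- (2 * t^2 * u^3)) \<and>
      commutator (x (- 3 *\<^sub>R \<alpha> - 2 *\<^sub>R \<beta>) u) (x \<beta> t) =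
        x (- 3 *\<^sub>R \<alpha> - \<beta>) (t * u) \<and>
      commutator (x (- \<alpha>) u) (x (\<alpha> + \<beta>) t) =
        x \<beta> (3 * t * u) \<and>
      commutator (x (- \<beta>) u) (x (\<alpha> + \<beta>) t) =
        x \<alpha> (- (t * u)) \<circ> x (2 *\<^sub>R \<alpha> + \<beta>) (- (t^2 * u)) \<circ> x (3 *\<^sub>R \<alpha> + 2 *\<^sub>R \<beta>) (- (t^3 * u)) \<circ> x (3 *\<^sub>R \<alpha> + \<beta>) (- (t^3 * u^2)) \<and>
      commutator (x (\<alpha> + \<beta>) u) (x (- \<beta>) t) =
        x \<alpha> (t * u) \<circ> x (2 *\<^sub>R \<alpha> + \<beta>) (t * u^2) \<circ> x (3 *\<^sub>R \<alpha> + 2 *\<^sub>R \<beta>) (t * u^3) \<circ> x (3 *\<^sub>R \<alpha> + \<beta>) (- (2 * t^2 * u^3)) \<and>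
      commutator (x (- 2 *\<^sub>R \<alpha> - \<beta>) u) (x (\<alpha> + \<beta>) t) =
        x (- \<alpha>) (- (2 * t * u)) \<circ> x \<beta> (- (3 * t^2 * u)) \<circ> x (- 3 *\<^sub>R \<alpha> - \<beta>) (3 * t * u^2) \<and>
      commutator (x (- 3 *\<^sub>R \<alpha> - 2 *\<^sub>R \<beta>) u) (x (\<alpha> + \<beta>) t) =
        x (- 2 *\<^sub>R \<alpha> - \<beta>) (- (t * u)) \<circ> x (- \<alpha>) (t^2 * u) \<circ> x \<beta> (t^3 * u) \<circ> x (- 3 *\<^sub>R \<alpha> - \<beta>) (t^3 * u^2) \<and>
      commutator (x (\<alpha> + \<beta>) u) (x (- 3 *\<^sub>R \<alpha> - 2 *\<^sub>R \<beta>) t) =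
        x (- 2 *\<^sub>R \<alpha> - \<beta>) (t * u) \<circ> x (- \<alpha>) (- (t * u^2)) \<circ> x \<beta> (- (t * u^3)) \<circ> x (- 3 *\<^sub>R \<alpha> - \<beta>) (2 * t^2 * u^3) \<and>
      commutator (x (- \<alpha>) u) (x (2 *\<^sub>R \<alpha> + \<beta>) t) =
        x (\<alpha> + \<beta>) (2 * t * u) \<circ> x (3 *\<^sub>R \<alpha> + 2 *\<^sub>R \<beta>) (- (3 * t^2 * u)) \<circ> x \<beta> (- (3 * t * u^2)) \<and>
      commutator (x (- \<alpha> - \<beta>) u) (x (2 *\<^sub>R \<alpha> + \<beta>) t) =
        x \<alpha> (- (2 * t * u)) \<circ> x (3 *\<^sub>R \<alpha> + \<beta>) (- (3 * t^2 * u)) \<circ> x (- \<beta>) (3 * t * u^2) \<and>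
      commutator (x (- 3 *\<^sub>R \<alpha> - \<beta>) u) (x (2 *\<^sub>R \<alpha> + \<beta>) t) =
        x (- \<alpha>) (- (t * u)) \<circ> x (\<alpha> + \<beta>) (- (t^2 * u)) \<circ> x (3 *\<^sub>R \<alpha> + 2 *\<^sub>R \<beta>) (t^3 * u) \<circ> x \<beta> (- (t^3 * u^2)) \<and>
      commutator (x (2 *\<^sub>R \<alpha> + \<beta>) u) (x (- 3 *\<^sub>R \<alpha> - \<beta>) t) =
        x (- \<alpha>) (t * u) \<circ> x (\<alpha> + \<beta>) (t * u^2) \<circ> x (3 *\<^sub>R \<alpha> + 2 *\<^sub>R \<beta>) (- (t * u^3)) \<circ> x \<beta> (- (2 * t^2 * u^3)) \<and>
      commutator (x (- 3 *\<^sub>R \<alpha> - 2 *\<^sub>R \<beta>) u) (x (2 *\<^sub>R \<alpha> + \<beta>) t) =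
        x (- \<alpha> - \<beta>) (t * u) \<circ> x \<alpha> (- (t^2 * u)) \<circ> x (3 *\<^sub>R \<alpha> + \<beta>) (- (t^3 * u)) \<circ> x (- \<beta>) (t^3 * u^2) \<and>
      commutator (x (2 *\<^sub>R \<alpha> + \<beta>) u) (x (- 3 *\<^sub>R \<alpha> - 2 *\<^sub>R \<beta>) t) =
        x (- \<alpha> - \<beta>) (- (t * u)) \<circ> x \<alpha> (t * u^2) \<circ> x (3 *\<^sub>R \<alpha> + \<beta>) (t * u^3) \<circ> x (- \<beta>) (2 * t^2 * u^3) \<and>
      commutator (x (- \<alpha>) u) (x (3 *\<^sub>R \<alpha> + \<beta>) t) =
        x (2 *\<^sub>R \<alpha> + \<beta>) (t * u) \<circ> x (\<alpha> + \<beta>) (- (t * u^2)) \<circ> x \<beta> (t * u^3) \<circ> x (3 *\<^sub>R \<alpha> + 2 *\<^sub>R \<beta>) (2 * t^2 * u^3) \<and>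
      commutator (x (3 *\<^sub>R \<alpha> + \<beta>) u) (x (- \<alpha>) t) =
        x (2 *\<^sub>R \<alpha> + \<beta>) (- (t * u)) \<circ> x (\<alpha> + \<beta>) (t^2 * u) \<circ> x \<beta> (- (t^3 * u)) \<circ> x (3 *\<^sub>R \<alpha> + 2 *\<^sub>R \<beta>) (t^3 * u^2) \<and>
      commutator (x (- 2 *\<^sub>R \<alpha> - \<beta>) u) (x (3 *\<^sub>R \<alpha> + \<beta>) t) =
        x \<alpha> (- (t * u)) \<circ> x (- \<alpha> - \<beta>) (t * u^2) \<circ> x (- 3 *\<^sub>R \<alpha> - 2 *\<^sub>R \<beta>) (t * u^3) \<circ> x (- \<beta>) (- (2 * t^2 * u^3)) \<and>
      commutator (x (3 *\<^sub>R \<alpha> + \<beta>) u) (x (- 2 *\<^sub>R \<alpha> - \<beta>) t) =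
        x \<alpha> (t * u) \<circ> x (- \<alpha> - \<beta>) (- (t^2 * u)) \<circ> x (- 3 *\<^sub>R \<alpha> - 2 *\<^sub>R \<beta>) (- (t^3 * u)) \<circ> x (- \<beta>) (- (t^3 * u^2)) \<and>
      commutator (x (- 3 *\<^sub>R \<alpha> - 2 *\<^sub>R \<beta>) u) (x (3 *\<^sub>R \<alpha> + \<beta>) t) =
        x (- \<beta>) (- (t * u)) \<and>
      commutator (x (- \<alpha> - \<beta>) u) (x (3 *\<^sub>R \<alpha> + 2 *\<^sub>R \<beta>) t) =
        x (2 *\<^sub>R \<alpha> + \<beta>) (- (t * u)) \<circ> x \<alpha> (- (t * u^2)) \<circ> x (- \<beta>) (t * u^3) \<circ> x (3 *\<^sub>R \<alpha> + \<beta>) (2 * t^2 * u^3) \<and>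
      commutator (x (3 *\<^sub>R \<alpha> + 2 *\<^sub>R \<beta>) u) (x (- \<alpha> - \<beta>) t) =
        x (2 *\<^sub>R \<alpha> + \<beta>) (t * u) \<circ> x \<alpha> (t^2 * u) \<circ> x (- \<beta>) (- (t^3 * u)) \<circ> x (3 *\<^sub>R \<alpha> + \<beta>) (t^3 * u^2) \<and>
      commutator (x (- 2 *\<^sub>R \<alpha> - \<beta>) u) (x (3 *\<^sub>R \<alpha> + 2 *\<^sub>R \<beta>) t) =
        x (\<alpha> + \<beta>) (t * u) \<circ> x (- \<alpha>) (t * u^2) \<circ> x (- 3 *\<^sub>R \<alpha> - \<beta>) (- (t * u^3)) \<circ> x \<beta> (2 * t^2 * u^3) \<and>
      commutator (x (3 *\<^sub>R \<alpha> + 2 *\<^sub>R \<beta>) u) (x (- 2 *\<^sub>R \<alpha> - \<beta>) t) =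
        x (\<alpha> + \<beta>) (- (t * u)) \<circ> x (- \<alpha>) (- (t^2 * u)) \<circ> x (- 3 *\<^sub>R \<alpha> - \<beta>) (t^3 * u) \<circ> x \<beta> (t^3 * u^2) \<and>
      commutator (x (- 3 *\<^sub>R \<alpha> - \<beta>) u) (x (3 *\<^sub>R \<alpha> + 2 *\<^sub>R \<beta>) t) =
        x \<beta> (- (t * u))"
proof -
  interpret G2_chevalley_basis scale bracket h e N
    by (rule assms(1))
  interpret G2_positive_basis scale bracket h e N
    by unfold_locales (use assms(2-5) in simp_all)
  show ?thesis
    \<comment> \<open>The order matters: rewriting \<open>- \<alpha>\<close> or \<alpha> itself at
      the start would destroy the compound roots in which they occur.\<close>
    unfolding assms(6) root_conversions(1-8) unfolding root_conversions(9,10) unfolding alpha_rt beta_rt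
    \<comment> \<open>For each of the 41 identities both sides are evaluated to literal lists, whose
      entries then agree after ring normalisation in t, u and the coordinates.\<close>
    by (intro allI conjI;
        rule commutator_eqI,
        simp, simp,
        simp only: Let_def o_apply root_element_rt,
        simp add: algebra_simps power2_eq_square power3_eq_cube)
qed

end
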